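(* Let $(G,g)$ be a connected, simply connected three-dimensional Lie group with a left-invariant Lorentzian metric of non-unimodular Type IV.1, i.e. its Lie algebra admits an orthonormal basis $\{e_1,e_2,e_3\}$ with $g(e_1,e_1)=-g(e_2,e_2)=-g(e_3,e_3)=-1$ and $$[e_1,e_2]=0,\quad [e_1,e_3]=\alpha e_1+\beta e_2,\quad [e_2,e_3]=\gamma e_1+\delta e_2,$$ for some $\alpha,\beta,\gamma,\delta\in\mathbb{R}$ with $\alpha+\delta\neq0$ and $\alpha\gamma-\beta\delta=0$. If there exist a left-invariant vector field $X$ on $G$ and $\lambda\in\mathbb{R}$ with $\mathcal{L}_Xg+C=\lambda g$, then $C=0$ (the left-invariant Cotton soliton is trivial).
   Context: Let $\nabla$ be the Levi-Civita connection of a three-dimensional pseudo-Riemannian manifold, $R(X,Y)=\nabla_{[X,Y]}-[\nabla_X,\nabla_Y]$, Ricci tensor $\rho(X,Y)=\operatorname{trace}\{Z\mapsto R(X,Z)Y\}$, scalar curvature $\tau$, Schouten tensor $S=\rho-\frac{\tau}{4}g$. The $(0,3)$-Cotton tensor is $C_{ijk}=(\nabla_iS)_{jk}-(\nabla_jS)_{ik}$, and the $(0,2)$-Cotton tensor is $C_{ij}=\frac{1}{2\sqrt{|\det g|}}C_{nmi}\,\epsilon^{nm\ell}g_{\ell j}$ with respect to positively oriented bases for a chosen orientation, where $\epsilon^{ijk}$ is the Levi-Civita symbol with $\epsilon^{123}=1$. A Cotton soliton is a vector field $X$ satisfying $\mathcal{L}_Xg+C=\lambda g$ for some $\lambda\in\mathbb{R}$;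 it is called trivial if $C=0$. *)

theory Defs
  imports "HOL-Analysis.Analysis" "HOL-Library.Function_Algebras" "HOL-Algebra.Group"
begin

text \<open>Tangent vectors are derivations, hence real-valued functions on real-valued functions; they
  are added and scaled pointwise.\<close>

instantiation "fun" :: (type, real_vector) real_vector
begin

definition scaleR_fun :: "real \<Rightarrow> ('a \<Rightarrow> 'b) \<Rightarrow> 'a \<Rightarrow> 'b" where
  "scaleR_fun c f = (\<lambda>x. c *\<^sub>R f x)"

instance
  by standard (auto simp: scaleR_fun_def fun_eq_iff algebra_simps)

end


section \<open>Smooth manifolds of dimension three\<close>

text \<open>Being \<open>C\<^sup>k\<close> on a set; meant for open sets only.\<close>

fun higher_differentiable_on ::
  "nat \<Rightarrow> ('a::euclidean_space \<Rightarrow> 'b::euclidean_space) \<Rightarrow> 'a set \<Rightarrow> bool" where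
  "higher_differentiable_on 0 f S \<longleftrightarrow> continuous_on S f"
| "higher_differentiable_on (Suc k) f S \<longleftrightarrow>
     (\<forall>x\<in>S. f differentiable (at x)) \<and>
     (\<forall>v. higher_differentiable_on k (\<lambda>x. frechet_derivative f (at x) v) S)"

definition smooth_on :: "'a set \<Rightarrow> ('a::euclidean_space \<Rightarrow> 'b::euclidean_space) \<Rightarrow> bool" where
  "smooth_on S f \<longleftrightarrow> (\<forall>k. higher_differentiable_on k f S)"

text \<open>A chart is a pair of its domain and a map, whose values outside the domain are irrelevant.\<close>

type_synonym 'a atlas = "('a set \<times> ('a \<Rightarrow> real^3)) set"

definition points :: "'a atlas \<Rightarrow> 'a set" where
  "points A = (\<Union>(U, \<phi>)\<in>A. U)"

definition smooth_manifold :: "'a topology \<Rightarrow> 'a atlas \<Rightarrow> bool" where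
  "smooth_manifold T A \<longleftrightarrow>
     Hausdorff_space T \<and> second_countable T \<and> topspace T = points A \<and>
     (\<forall>(U, \<phi>)\<in>A. openin T U \<and> open (\<phi> ` U) \<and>
        homeomorphic_map (subtopology T U) (top_of_set (\<phi> ` U)) \<phi>) \<and>
     (\<forall>(U, \<phi>)\<in>A. \<forall>(V, \<psi>)\<in>A. smooth_on (\<phi> ` (U \<inter> V)) (\<psi> \<circ> inv_into U \<phi>))"

text \<open>The free-homotopy characterisation used by \<^const>\<open>simply_connected\<close>, for an abstract
  topology.\<close>

definition simply_connected_space :: "'a topology \<Rightarrow> bool" where
  "simply_connected_space T \<longleftrightarrow>
     (\<forall>p q. pathin T p \<and> p 1 = p 0 \<and> pathin T q \<and> q 1 = q 0 \<longrightarrow>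
        homotopic_with (\<lambda>r. r 1 = r 0) (top_of_set {0..1}) T p q)"

definition smooth_functions :: "'a atlas \<Rightarrow> ('a \<Rightarrow> real) set" where
  "smooth_functions A = {f. \<forall>(U, \<phi>)\<in>A. smooth_on (\<phi> ` U) (f \<circ> inv_into U \<phi>)}"

type_synonym 'a tangent = "('a \<Rightarrow> real) \<Rightarrow> real"
type_synonym 'a field = "'a \<Rightarrow> 'a tangent"

text \<open>Derivations at \<open>p\<close> of the algebra of smooth functions, made unique as HOL functions by the
  value \<open>0\<close> at functions that are not smooth. By the Leibniz rule they do not see the values of
  functions outside the manifold.\<close>

definition tangent_space :: "'a atlas \<Rightarrow> 'a \<Rightarrow> 'a tangent set" where
  "tangent_space A p = {v.
     (\<forall>f. f \<notin> smooth_functions A \<longrightarrow> v f = 0) \<and>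
     (\<forall>f\<in>smooth_functions A. \<forall>h\<in>smooth_functions A. v (\<lambda>x. f x + h x) = v f + v h) \<and>
     (\<forall>c. \<forall>f\<in>smooth_functions A. v (\<lambda>x. c * f x) = c * v f) \<and>
     (\<forall>f\<in>smooth_functions A. \<forall>h\<in>smooth_functions A.
        v (\<lambda>x. f x * h x) = f p * v h + h p * v f)}"

definition vector_fields :: "'a atlas \<Rightarrow> 'a field set" where
  "vector_fields A = {X.
     (\<forall>p\<in>points A. X p \<in> tangent_space A p) \<and>
     (\<forall>p. p \<notin> points A \<longrightarrow> X p = 0) \<and>
     (\<forall>f\<in>smooth_functions A. (\<lambda>p. X p f) \<in> smooth_functions A)}"

definition fmult :: "('a \<Rightarrow> real) \<Rightarrow> 'a field \<Rightarrow> 'a field" where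
  "fmult f X = (\<lambda>p. f p *\<^sub>R X p)"

definition lie_bracket :: "'a field \<Rightarrow> 'a field \<Rightarrow> 'a field" where
  "lie_bracket X Y = (\<lambda>p f. X p (\<lambda>q. Y q f) - Y p (\<lambda>q. X q f))"


section \<open>Linear algebra on three-dimensional spaces\<close>

definition is_frame :: "'v::real_vector set \<Rightarrow> (3 \<Rightarrow> 'v) \<Rightarrow> bool" where
  "is_frame V b \<longleftrightarrow> inj b \<and> independent (range b) \<and> span (range b) = V"

definition change_of_frame :: "(3 \<Rightarrow> 'v::real_vector) \<Rightarrow> (3 \<Rightarrow> 'v) \<Rightarrow> real^3^3" where
  "change_of_frame b b' = (\<chi> i j. representation (range b) (b' i) (b j))"

definition trace_on :: "'v::real_vector set \<Rightarrow> ('v \<Rightarrow> 'v) \<Rightarrow> real" where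
  "trace_on V L = (let B = (SOME B. independent B \<and> span B = V)
                   in \<Sum>b\<in>B. representation B (L b) b)"

definition gram :: "('v \<Rightarrow> 'v \<Rightarrow> real) \<Rightarrow> (3 \<Rightarrow> 'v) \<Rightarrow> real^3^3" where
  "gram h b = (\<chi> i j. h (b i) (b j))"

definition levi_civita_symbol :: "3 \<Rightarrow> 3 \<Rightarrow> 3 \<Rightarrow> real" where
  "levi_civita_symbol i j k =
     (if (i, j, k) \<in> {(1, 2, 3), (2, 3, 1), (3, 1, 2)} then 1
      else if (i, j, k) \<in> {(2, 1, 3), (1, 3, 2), (3, 2, 1)} then - 1
      else 0)"

definition lorentz_sign :: "3 \<Rightarrow> 3 \<Rightarrow> real" where
  "lorentz_sign i j = (if i \<noteq> j then 0 else if i = 1 then - 1 else 1)"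


section \<open>Lorentzian metrics and curvature\<close>

type_synonym 'a metric = "'a \<Rightarrow> 'a tangent \<Rightarrow> 'a tangent \<Rightarrow> real"
type_synonym 'a connection = "'a field \<Rightarrow> 'a field \<Rightarrow> 'a field"

definition lorentzian_metric :: "'a atlas \<Rightarrow> 'a metric \<Rightarrow> bool" where
  "lorentzian_metric A g \<longleftrightarrow>
     (\<forall>p\<in>points A. \<forall>u\<in>tangent_space A p. \<forall>v\<in>tangent_space A p. g p u v = g p v u) \<and>
     (\<forall>p\<in>points A. \<forall>u\<in>tangent_space A p. \<forall>v\<in>tangent_space A p. \<forall>w\<in>tangent_space A p. \<forall>c.
        g p (u + v) w = g p u w + g p v w \<and> g p (c *\<^sub>R u) w = c * g p u w) \<and>
     (\<forall>p\<in>points A. \<exists>b. is_frame (tangent_space A p) b \<and>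
        (\<forall>i j. g p (b i) (b j) = lorentz_sign i j)) \<and>
     (\<forall>X\<in>vector_fields A. \<forall>Y\<in>vector_fields A. (\<lambda>p. g p (X p) (Y p)) \<in> smooth_functions A)"

definition levi_civita_connection :: "'a atlas \<Rightarrow> 'a metric \<Rightarrow> 'a connection \<Rightarrow> bool" where
  "levi_civita_connection A g D \<longleftrightarrow>
     (\<forall>X\<in>vector_fields A. \<forall>Y\<in>vector_fields A. D X Y \<in> vector_fields A) \<and>
     (\<forall>X\<in>vector_fields A. \<forall>X'\<in>vector_fields A. \<forall>Y\<in>vector_fields A.
        D (X + X') Y = D X Y + D X' Y) \<and>
     (\<forall>f\<in>smooth_functions A. \<forall>X\<in>vector_fields A. \<forall>Y\<in>vector_fields A.
        D (fmult f X) Y = fmult f (D X Y)) \<and>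
     (\<forall>X\<in>vector_fields A. \<forall>Y\<in>vector_fields A. \<forall>Y'\<in>vector_fields A.
        D X (Y + Y') = D X Y + D X Y') \<and>
     (\<forall>f\<in>smooth_functions A. \<forall>X\<in>vector_fields A. \<forall>Y\<in>vector_fields A.
        D X (fmult f Y) = fmult (\<lambda>p. X p f) Y + fmult f (D X Y)) \<and>
     (\<forall>X\<in>vector_fields A. \<forall>Y\<in>vector_fields A. D X Y - D Y X = lie_bracket X Y) \<and>
     (\<forall>X\<in>vector_fields A. \<forall>Y\<in>vector_fields A. \<forall>Z\<in>vector_fields A. \<forall>p\<in>points A.
        X p (\<lambda>q. g q (Y q) (Z q)) = g p (D X Y p) (Z p) + g p (Y p) (D X Z p))"

definition curvature :: "'a connection \<Rightarrow> 'a field \<Rightarrow> 'a field \<Rightarrow> 'a field \<Rightarrow> 'a field" where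
  "curvature D X Y Z = D (lie_bracket X Y) Z - (D X (D Y Z) - D Y (D X Z))"

text \<open>Some vector field with a given value at a point. The tensors below are function-linear
  expressions in vector fields, so that their values at \<open>p\<close> do not depend on this choice.\<close>

definition extension :: "'a atlas \<Rightarrow> 'a \<Rightarrow> 'a tangent \<Rightarrow> 'a field" where
  "extension A p v = (SOME X. X \<in> vector_fields A \<and> X p = v)"

definition ricci :: "'a atlas \<Rightarrow> 'a connection \<Rightarrow> 'a metric" where
  "ricci A D p u v = trace_on (tangent_space A p)
     (\<lambda>w. curvature D (extension A p u) (extension A p w) (extension A p v) p)"

text \<open>The contraction \<open>g\<^sup>i\<^sup>j \<rho>\<^sub>i\<^sub>j\<close>, in any frame.\<close>

definition scalar_curvature :: "'a atlas \<Rightarrow> 'a metric \<Rightarrow> 'a connection \<Rightarrow> 'a \<Rightarrow> real" where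
  "scalar_curvature A g D p =
     (let b = (SOME b. is_frame (tangent_space A p) b)
      in \<Sum>i\<in>UNIV. \<Sum>j\<in>UNIV. matrix_inv (gram (g p) b) $ i $ j * ricci A D p (b i) (b j))"

definition schouten :: "'a atlas \<Rightarrow> 'a metric \<Rightarrow> 'a connection \<Rightarrow> 'a metric" where
  "schouten A g D p u v = ricci A D p u v - scalar_curvature A g D p / 4 * g p u v"

definition covariant_derivative ::
  "'a connection \<Rightarrow> 'a metric \<Rightarrow> 'a field \<Rightarrow> 'a field \<Rightarrow> 'a field \<Rightarrow> 'a \<Rightarrow> real" where
  "covariant_derivative D S X Y Z p =
     X p (\<lambda>q. S q (Y q) (Z q)) - S p (D X Y p) (Z p) - S p (Y p) (D X Z p)"

definition cotton_03 ::
  "'a atlas \<Rightarrow> 'a metric \<Rightarrow> 'a connection \<Rightarrow> 'a \<Rightarrow> 'a tangent \<Rightarrow> 'a tangent \<Rightarrow> 'a tangent \<Rightarrow> real" where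
  "cotton_03 A g D p u v w =
     (let X = extension A p u; Y = extension A p v; Z = extension A p w
      in covariant_derivative D (schouten A g D) X Y Z p
         - covariant_derivative D (schouten A g D) Y X Z p)"

text \<open>An orientation is given by the positively oriented frames at each point; nearby points are
  linked by smooth frames.\<close>

definition orientation :: "'a topology \<Rightarrow> 'a atlas \<Rightarrow> ('a \<Rightarrow> (3 \<Rightarrow> 'a tangent) set) \<Rightarrow> bool" where
  "orientation T A Or \<longleftrightarrow>
     (\<forall>p\<in>points A. Or p \<noteq> {} \<and> (\<forall>b\<in>Or p. is_frame (tangent_space A p) b \<and>
        (\<forall>b'. b' \<in> Or p \<longleftrightarrow> is_frame (tangent_space A p) b' \<and> det (change_of_frame b b') > 0))) \<and>
     (\<forall>p\<in>points A. \<exists>U X. openin T U \<and> p \<in> U \<and> (\<forall>i. X i \<in> vector_fields A) \<and>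
        (\<forall>q\<in>U. (\<lambda>i. X i q) \<in> Or q))"

text \<open>\<open>C\<^sub>i\<^sub>j\<close> for a positively oriented frame \<open>b\<close>, with arbitrary tangent vectors \<open>u\<close>, \<open>v\<close> in place
  of the frame vectors with indices \<open>i\<close>, \<open>j\<close>.\<close>

definition cotton ::
  "'a atlas \<Rightarrow> 'a metric \<Rightarrow> ('a \<Rightarrow> (3 \<Rightarrow> 'a tangent) set) \<Rightarrow> 'a connection \<Rightarrow> 'a metric" where
  "cotton A g Or D p u v =
     (let b = (SOME b. b \<in> Or p)
      in 1 / (2 * sqrt \<bar>det (gram (g p) b)\<bar>) *
         (\<Sum>n\<in>UNIV. \<Sum>m\<in>UNIV. \<Sum>l\<in>UNIV.
            cotton_03 A g D p (b n) (b m) u * levi_civita_symbol n m l * g p (b l) v))"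

definition lie_derivative_metric ::
  "'a metric \<Rightarrow> 'a field \<Rightarrow> 'a field \<Rightarrow> 'a field \<Rightarrow> 'a \<Rightarrow> real" where
  "lie_derivative_metric g X Y Z p =
     X p (\<lambda>q. g q (Y q) (Z q)) - g p (lie_bracket X Y p) (Z p) - g p (Y p) (lie_bracket X Z p)"

definition cotton_soliton ::
  "'a atlas \<Rightarrow> 'a metric \<Rightarrow> ('a \<Rightarrow> (3 \<Rightarrow> 'a tangent) set) \<Rightarrow> 'a connection \<Rightarrow> 'a field \<Rightarrow> real \<Rightarrow> bool" where
  "cotton_soliton A g Or D X c \<longleftrightarrow> X \<in> vector_fields A \<and>
     (\<forall>Y\<in>vector_fields A. \<forall>Z\<in>vector_fields A. \<forall>p\<in>points A.
        lie_derivative_metric g X Y Z p + cotton A g Or D p (Y p) (Z p) = c * g p (Y p) (Z p))"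


section \<open>Lie groups\<close>

definition lie_group :: "('a, 'm) monoid_scheme \<Rightarrow> 'a topology \<Rightarrow> 'a atlas \<Rightarrow> bool" where
  "lie_group G T A \<longleftrightarrow>
     group G \<and> smooth_manifold T A \<and> carrier G = points A \<and>
     continuous_map (prod_topology T T) T (\<lambda>(x, y). x \<otimes>\<^bsub>G\<^esub> y) \<and>
     continuous_map T T (\<lambda>x. inv\<^bsub>G\<^esub> x) \<and>
     (\<forall>(U, \<phi>)\<in>A. \<forall>(V, \<psi>)\<in>A. \<forall>(W, \<theta>)\<in>A.
        smooth_on {(\<phi> x, \<psi> y) |x y. x \<in> U \<and> y \<in> V \<and> x \<otimes>\<^bsub>G\<^esub> y \<in> W}
          (\<lambda>(s, t). \<theta> (inv_into U \<phi> s \<otimes>\<^bsub>G\<^esub> inv_into V \<psi> t))) \<and>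
     (\<forall>(U, \<phi>)\<in>A. \<forall>(V, \<psi>)\<in>A.
        smooth_on {\<phi> x |x. x \<in> U \<and> inv\<^bsub>G\<^esub> x \<in> V} (\<lambda>s. \<psi> (inv\<^bsub>G\<^esub> (inv_into U \<phi> s))))"

definition d_left_translation ::
  "('a, 'm) monoid_scheme \<Rightarrow> 'a atlas \<Rightarrow> 'a \<Rightarrow> 'a tangent \<Rightarrow> 'a tangent" where
  "d_left_translation G A a v =
     (\<lambda>f. if f \<in> smooth_functions A then v (\<lambda>x. f (a \<otimes>\<^bsub>G\<^esub> x)) else 0)"

definition left_invariant_fields :: "('a, 'm) monoid_scheme \<Rightarrow> 'a atlas \<Rightarrow> 'a field set" where
  "left_invariant_fields G A = {X \<in> vector_fields A.
     \<forall>a\<in>carrier G. \<forall>p\<in>carrier G. X (a \<otimes>\<^bsub>G\<^esub> p) = d_left_translation G A a (X p)}"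

definition left_invariant_metric :: "('a, 'm) monoid_scheme \<Rightarrow> 'a atlas \<Rightarrow> 'a metric \<Rightarrow> bool" where
  "left_invariant_metric G A g \<longleftrightarrow>
     (\<forall>a\<in>carrier G. \<forall>p\<in>carrier G. \<forall>u\<in>tangent_space A p. \<forall>v\<in>tangent_space A p.
        g (a \<otimes>\<^bsub>G\<^esub> p) (d_left_translation G A a u) (d_left_translation G A a v) = g p u v)"

text \<open>The sign convention of \<^const>\<open>lorentz_sign\<close> makes \<open>e 1\<close> timelike.\<close>

definition nonunimodular_type_IV1 :: "('a, 'm) monoid_scheme \<Rightarrow> 'a atlas \<Rightarrow> 'a metric \<Rightarrow> bool" where
  "nonunimodular_type_IV1 G A g \<longleftrightarrow>
     (\<exists>e \<alpha> \<beta> \<gamma> \<delta>. is_frame (left_invariant_fields G A) e \<and>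
        (\<forall>i j. \<forall>p\<in>carrier G. g p (e i p) (e j p) = lorentz_sign i j) \<and>
        lie_bracket (e 1) (e 2) = 0 \<and>
        lie_bracket (e 1) (e 3) = \<alpha> *\<^sub>R e 1 + \<beta> *\<^sub>R e 2 \<and>
        lie_bracket (e 2) (e 3) = \<gamma> *\<^sub>R e 1 + \<delta> *\<^sub>R e 2 \<and>
        \<alpha> + \<delta> \<noteq> 0 \<and> \<alpha> * \<gamma> - \<beta> * \<delta> = 0)"

end

theory Submission
  imports Defs
begin

text \<open>The left-invariant frame \<open>e\<close> is orthonormal at every point and its brackets have constant
  coefficients, so every invariant of the metric is a fixed array of numbers in this frame. The
  theorem is then a statement about finitely many polynomials in \<open>\<alpha>\<close>, \<open>\<beta>\<close>, \<open>\<gamma>\<close>, \<open>\<delta>\<close>.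

  The passage to numbers rests on tensoriality. The metric supplies smooth coefficients
  \<open>\<plusminus> g(X, e\<^sub>i)\<close> of any vector field \<open>X\<close>, so the \<open>e\<^sub>i\<close> generate the vector fields as a module over the
  smooth functions, and a function-linear expression in vector fields is determined at a point by its
  values on the \<open>e\<^sub>i\<close> (\<open>tensorial_expansion\<close>). The Koszul formula gives the connection on the frame
  (\<open>D_frame\<close>); curvature, Ricci tensor, scalar curvature, Schouten tensor and Cotton tensor follow in
  turn. In all of these the arbitrary choices of extensions, bases and frames cancel, except for
  the sign of the \<open>(0,2)\<close>-Cotton tensor, which depends on the orientation (\<open>cotton_in_frame\<close>). That
  sign may be treated as unknown at each point separately.

  For Type IV.1 the condition \<open>\<alpha>\<gamma> = \<beta>\<delta>\<close> together with \<open>\<alpha> + \<delta> \<noteq> 0\<close> allows one to write \<open>\<alpha> = m\<close>,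
  \<open>\<beta> = m v\<close>, \<open>\<gamma> = n v\<close>, \<open>\<delta> = n\<close>. With \<open>X = \<Sum> x\<^sub>i e\<^sub>i\<close> and the orientation sign \<open>s\<close>, the soliton
  equation at \<open>(1,1)\<close>, \<open>(2,2)\<close>, \<open>(3,3)\<close> involves only \<open>x\<^sub>3\<close> and \<open>\<lambda>\<close> apart from the Cotton components.
  The Cotton tensor is trace-free, so the trace gives \<open>3\<lambda> = 2 x\<^sub>3 (m + n)\<close>; comparison with the
  explicit components leaves \<open>w ((m - n)\<^sup>2 + 2 m\<^sup>2 + 2 n\<^sup>2) = 0\<close> for
  \<open>w = s v (v\<^sup>2 - 1) (m - n) / 2\<close>. The second factor is positive, hence \<open>w = 0\<close>, hence \<open>x\<^sub>3 = \<lambda> = 0\<close>, and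
  the equation reduces to the vanishing of the Cotton tensor
  (\<open>soliton_equations_imp_cotton_zero\<close>).\<close>


section \<open>The algebra of smooth functions\<close>

text \<open>Openness matters: the Frechet derivative at a point of \<open>S\<close> then depends only on the values
  on \<open>S\<close>.\<close>

lemma higher_differentiable_on_cong:
  assumes "open S" and "\<And>x. x \<in> S \<Longrightarrow> f x = g x" and "higher_differentiable_on k f S"
  shows "higher_differentiable_on k g S"
  using assms(2,3)
proof (induction k arbitrary: f g)
  case 0
  then show ?case
    by (simp cong: continuous_on_cong)
next
  case (Suc k)
  have diff: "f differentiable (at x)" if "x \<in> S" for x
    using Suc.prems that by simp
  have fg: "frechet_derivative f (at x) = frechet_derivative g (at x)" if "x \<in> S" for x
    by (rule frechet_derivative_transform_within_open[OF diff[OF that] assms(1) that])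
      (use Suc.prems in auto)
  have "g differentiable (at x)" if "x \<in> S" for x
    using diff[OF that] has_derivative_transform_within_open[OF _ assms(1) that, of f _ UNIV g] Suc.prems(1)
    unfolding differentiable_def by blast
  moreover have "higher_differentiable_on k (\<lambda>x. frechet_derivative g (at x) v) S" for v
    by (rule Suc.IH[of "\<lambda>x. frechet_derivative f (at x) v"]) (use Suc.prems fg in auto)
  ultimately show ?case
    by simp
qed

lemma higher_differentiable_on_SucD:
  "higher_differentiable_on (Suc k) f S \<Longrightarrow> higher_differentiable_on k f S"
proof (induction k arbitrary: f)
  case 0
  then show ?case
    by (auto intro!: continuous_at_imp_continuous_on differentiable_imp_continuous_within)
next
  case (Suc k)
  then show ?case
    by (meson higher_differentiable_on.simps(2))
qed

lemma higher_differentiable_on_const: "higher_differentiable_on k (\<lambda>_. c) S"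
  by (induction k arbitrary: c) auto

lemma higher_differentiable_on_add:
  assumes "open S" and "higher_differentiable_on k f S" and "higher_differentiable_on k g S"
  shows "higher_differentiable_on k (\<lambda>x. f x + g x) S"
  using assms(2,3)
proof (induction k arbitrary: f g)
  case 0
  then show ?case
    by (simp add: continuous_on_add)
next
  case (Suc k)
  have fr: "frechet_derivative f (at x) v + frechet_derivative g (at x) v
      = frechet_derivative (\<lambda>x. f x + g x) (at x) v" if "x \<in> S" for x v
  proof -
    have "(f has_derivative frechet_derivative f (at x)) (at x)"
      "(g has_derivative frechet_derivative g (at x)) (at x)"
      using Suc.prems that by (simp_all flip: frechet_derivative_works)
    from has_derivative_add[OF this] show ?thesis
      by (subst frechet_derivative_at[symmetric]) auto
  qed
  have "higher_differentiable_on k (\<lambda>x. frechet_derivative (\<lambda>x. f x + g x) (at x) v) S" for v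
    by (rule higher_differentiable_on_cong[OF assms(1) fr]) (use Suc in auto)
  then show ?case
    using Suc.prems by simp
qed

lemma higher_differentiable_on_mult:
  fixes f g :: "'a::euclidean_space \<Rightarrow> real"
  assumes "open S" and "higher_differentiable_on k f S" and "higher_differentiable_on k g S"
  shows "higher_differentiable_on k (\<lambda>x. f x * g x) S"
  using assms(2,3)
proof (induction k arbitrary: f g)
  case 0
  then show ?case
    by (simp add: continuous_on_mult)
next
  case (Suc k)
  have fr: "frechet_derivative f (at x) v * g x + f x * frechet_derivative g (at x) v
      = frechet_derivative (\<lambda>x. f x * g x) (at x) v" if "x \<in> S" for x v
  proof -
    have "(f has_derivative frechet_derivative f (at x)) (at x)"
      "(g has_derivative frechet_derivative g (at x)) (at x)"
      using Suc.prems that by (simp_all flip: frechet_derivative_works)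
    from has_derivative_mult[OF this] show ?thesis
      by (subst frechet_derivative_at[symmetric]) (auto simp: algebra_simps)
  qed
  have "higher_differentiable_on k (\<lambda>x. frechet_derivative (\<lambda>x. f x * g x) (at x) v) S" for v
    by (rule higher_differentiable_on_cong[OF assms(1) fr])
      (use Suc.prems in \<open>auto intro!: higher_differentiable_on_add assms(1) Suc.IH
          intro: higher_differentiable_on_SucD\<close>)
  then show ?case
    using Suc.prems by simp
qed

lemma smooth_functionsI:
  assumes "\<And>U \<phi> k. (U, \<phi>) \<in> A \<Longrightarrow> higher_differentiable_on k (\<lambda>x. f (inv_into U \<phi> x)) (\<phi> ` U)"
  shows "f \<in> smooth_functions A"
  using assms by (auto simp: smooth_functions_def smooth_on_def o_def)

lemma smooth_functionsD:
  "f \<in> smooth_functions A \<Longrightarrow> (U, \<phi>) \<in> A \<Longrightarrow>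
    higher_differentiable_on k (\<lambda>x. f (inv_into U \<phi> x)) (\<phi> ` U)"
  by (auto simp: smooth_functions_def smooth_on_def o_def)

lemma smooth_const: "(\<lambda>_. c) \<in> smooth_functions A"
  by (auto intro!: smooth_functionsI higher_differentiable_on_const)

lemma sum_fun_apply: "(\<Sum>i\<in>I. F i) x = (\<Sum>i\<in>I. F i x)"
  by (induction I rule: infinite_finite_induct) auto

lemma scaleR_fun_apply: "(c *\<^sub>R F) x = c *\<^sub>R F x"
  by (simp add: scaleR_fun_def)

lemma fmult_apply: "fmult f X p = f p *\<^sub>R X p"
  by (simp add: fmult_def)

text \<open>Openness of the chart images is what makes the smooth functions an algebra, by the lemmas
  above applied in each chart.\<close>

locale open_charts =
  fixes A :: "'a atlas"
  assumes open_chart: "(U, \<phi>) \<in> A \<Longrightarrow> open (\<phi> ` U)"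
begin

lemma smooth_add:
  "f \<in> smooth_functions A \<Longrightarrow> h \<in> smooth_functions A \<Longrightarrow> (\<lambda>x. f x + h x) \<in> smooth_functions A"
  by (auto intro!: smooth_functionsI higher_differentiable_on_add open_chart dest: smooth_functionsD)

lemma smooth_mult:
  "f \<in> smooth_functions A \<Longrightarrow> h \<in> smooth_functions A \<Longrightarrow> (\<lambda>x. f x * h x) \<in> smooth_functions A"
  by (auto intro!: smooth_functionsI higher_differentiable_on_mult open_chart dest: smooth_functionsD)

lemma smooth_cmult: "f \<in> smooth_functions A \<Longrightarrow> (\<lambda>x. c * f x) \<in> smooth_functions A"
  by (intro smooth_mult smooth_const)

lemma smooth_diff:
  "f \<in> smooth_functions A \<Longrightarrow> h \<in> smooth_functions A \<Longrightarrow> (\<lambda>x. f x - h x) \<in> smooth_functions A"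
  using smooth_add[OF _ smooth_cmult[of h "-1"], of f] by simp

lemma smooth_sum:
  "(\<And>i. i \<in> I \<Longrightarrow> f i \<in> smooth_functions A) \<Longrightarrow> (\<lambda>x. \<Sum>i\<in>I. f i x) \<in> smooth_functions A"
  by (induction I rule: infinite_finite_induct) (auto intro!: smooth_const smooth_add)

lemma smooth_cong:
  assumes "f \<in> smooth_functions A" and "\<And>p. p \<in> points A \<Longrightarrow> f p = h p"
  shows "h \<in> smooth_functions A"
proof (rule smooth_functionsI)
  fix U \<phi> k
  assume U: "(U, \<phi>) \<in> A"
  then have "inv_into U \<phi> x \<in> points A" if "x \<in> \<phi> ` U" for x
    using inv_into_into[OF that] by (auto simp: points_def)
  then show "higher_differentiable_on k (\<lambda>x. h (inv_into U \<phi> x)) (\<phi> ` U)"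
    using assms by (auto intro!: higher_differentiable_on_cong[OF open_chart[OF U] _ smooth_functionsD[OF assms(1) U]])
qed


section \<open>Derivations and vector fields\<close>

lemma tangent_add:
  "v \<in> tangent_space A p \<Longrightarrow> f \<in> smooth_functions A \<Longrightarrow> h \<in> smooth_functions A \<Longrightarrow>
    v (\<lambda>x. f x + h x) = v f + v h"
  by (simp add: tangent_space_def)

lemma tangent_cmult:
  "v \<in> tangent_space A p \<Longrightarrow> f \<in> smooth_functions A \<Longrightarrow> v (\<lambda>x. c * f x) = c * v f"
  by (simp add: tangent_space_def)

lemma tangent_mult:
  "v \<in> tangent_space A p \<Longrightarrow> f \<in> smooth_functions A \<Longrightarrow> h \<in> smooth_functions A \<Longrightarrow>
    v (\<lambda>x. f x * h x) = f p * v h + h p * v f"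
  by (simp add: tangent_space_def)

lemma tangent_diff:
  "v \<in> tangent_space A p \<Longrightarrow> f \<in> smooth_functions A \<Longrightarrow> h \<in> smooth_functions A \<Longrightarrow>
    v (\<lambda>x. f x - h x) = v f - v h"
  using tangent_add[OF _ _ smooth_cmult[of h "-1"], of v p f] tangent_cmult[of v p h "-1"] by simp

lemma tangent_const: "v \<in> tangent_space A p \<Longrightarrow> v (\<lambda>_. c) = 0"
  using tangent_mult[of v p "\<lambda>_. 1" "\<lambda>_. 1"] tangent_cmult[of v p "\<lambda>_. 1" c] by (simp add: smooth_const)

text \<open>A difference \<open>d\<close> that vanishes on the manifold equals its product with the indicator function of
  the complement, so the Leibniz rule gives \<open>v d = 0\<close>. Identities such as orthonormality are
  assumed on the manifold only, and can be differentiated by this lemma.\<close>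

lemma tangent_cong:
  assumes v: "v \<in> tangent_space A p" and p: "p \<in> points A"
    and f: "f \<in> smooth_functions A" and eq: "\<And>q. q \<in> points A \<Longrightarrow> f q = h q"
  shows "v f = v h"
proof -
  have h: "h \<in> smooth_functions A"
    using smooth_cong[OF f eq] .
  define k :: "'a \<Rightarrow> real" where "k = (\<lambda>q. if q \<in> points A then 0 else 1)"
  have k: "k \<in> smooth_functions A"
    by (rule smooth_cong[OF smooth_const[of 0]]) (simp add: k_def)
  have "(\<lambda>q. f q - h q) = (\<lambda>q. (f q - h q) * k q)"
    using eq by (auto simp: k_def)
  then have "v (\<lambda>q. f q - h q) = (f p - h p) * v k + k p * v (\<lambda>q. f q - h q)"
    using tangent_mult[OF v smooth_diff[OF f h] k] by simp
  then show ?thesis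
    using tangent_diff[OF v f h] eq[OF p] p by (simp add: k_def)
qed

lemma subspace_tangent_space: "subspace (tangent_space A p)"
  unfolding subspace_def
  by (auto simp: tangent_space_def scaleR_fun_def algebra_simps)

lemma vector_field_tangent: "X \<in> vector_fields A \<Longrightarrow> p \<in> points A \<Longrightarrow> X p \<in> tangent_space A p"
  by (simp add: vector_fields_def)

lemma vector_field_smooth:
  "X \<in> vector_fields A \<Longrightarrow> f \<in> smooth_functions A \<Longrightarrow> (\<lambda>p. X p f) \<in> smooth_functions A"
  by (simp add: vector_fields_def)

lemma vector_field_add: "X \<in> vector_fields A \<Longrightarrow> Y \<in> vector_fields A \<Longrightarrow> X + Y \<in> vector_fields A"
  using subspace_add[OF subspace_tangent_space] by (auto simp: vector_fields_def intro!: smooth_add)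

lemma vector_field_fmult:
  "f \<in> smooth_functions A \<Longrightarrow> X \<in> vector_fields A \<Longrightarrow> fmult f X \<in> vector_fields A"
  using subspace_scale[OF subspace_tangent_space]
  by (auto simp: vector_fields_def fmult_def scaleR_fun_apply intro!: smooth_mult)

lemma scaleR_eq_fmult: "c *\<^sub>R X = fmult (\<lambda>_. c) X"
  by (simp add: fmult_def scaleR_fun_def)

lemma vector_field_scaleR: "X \<in> vector_fields A \<Longrightarrow> c *\<^sub>R X \<in> vector_fields A"
  unfolding scaleR_eq_fmult by (rule vector_field_fmult[OF smooth_const])

lemma vector_field_zero: "0 \<in> vector_fields A"
  using subspace_0[OF subspace_tangent_space] by (auto simp: vector_fields_def smooth_const)

lemma vector_field_sum:
  "(\<And>i. i \<in> I \<Longrightarrow> X i \<in> vector_fields A) \<Longrightarrow> (\<Sum>i\<in>I. X i) \<in> vector_fields A"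
  by (induction I rule: infinite_finite_induct) (auto intro!: vector_field_zero vector_field_add)

lemma vector_field_diff: "X \<in> vector_fields A \<Longrightarrow> Y \<in> vector_fields A \<Longrightarrow> X - Y \<in> vector_fields A"
  using vector_field_add[OF _ vector_field_scaleR[of Y "-1"], of X] by simp

end


section \<open>Orthonormal frames and structure constants\<close>

text \<open>The pointwise form of linearity over the smooth functions, for an expression \<open>F\<close> in one vector
  field that is evaluated at \<open>p\<close>.\<close>

definition tensorial_at :: "'a atlas \<Rightarrow> 'a \<Rightarrow> ('a field \<Rightarrow> 'v::real_vector) \<Rightarrow> bool" where
  "tensorial_at A p F \<longleftrightarrow>
     (\<forall>X\<in>vector_fields A. \<forall>Y\<in>vector_fields A. F (X + Y) = F X + F Y) \<and>
     (\<forall>f\<in>smooth_functions A. \<forall>X\<in>vector_fields A. F (fmult f X) = f p *\<^sub>R F X)"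

text \<open>The coefficient of \<open>e\<^sub>k\<close> in \<open>\<nabla>\<close> of \<open>e\<^sub>j\<close> along \<open>e\<^sub>i\<close>, as the Koszul formula gives it when
  \<open>c i j k\<close> is the coefficient of \<open>e\<^sub>k\<close> in \<open>[e\<^sub>i, e\<^sub>j]\<close>. The factors \<^term>\<open>lorentz_sign i i\<close> lower
  and raise indices.\<close>

definition christoffel :: "(3 \<Rightarrow> 3 \<Rightarrow> 3 \<Rightarrow> real) \<Rightarrow> 3 \<Rightarrow> 3 \<Rightarrow> 3 \<Rightarrow> real" where
  "christoffel c i j k = lorentz_sign k k / 2 *
     (c i j k * lorentz_sign k k - c j k i * lorentz_sign i i + c k i j * lorentz_sign j j)"

lemma lorentz_sign_square [simp]: "lorentz_sign i i * lorentz_sign i i = 1"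
  by (simp add: lorentz_sign_def)

lemma lorentz_sign_square_left [simp]: "lorentz_sign i i * (lorentz_sign i i * x) = x"
  by (simp add: lorentz_sign_def)

lemma sum_lorentz_sign [simp]:
  "(\<Sum>i\<in>UNIV. x i * lorentz_sign i j) = x j * lorentz_sign j j"
  "(\<Sum>i\<in>UNIV. x i * lorentz_sign j i) = x j * lorentz_sign j j"
proof -
  have "(\<Sum>i\<in>UNIV. x i * lorentz_sign i j) = (\<Sum>i\<in>UNIV. if i = j then x i * lorentz_sign i j else 0)"
    by (rule sum.cong) (auto simp: lorentz_sign_def)
  then show "(\<Sum>i\<in>UNIV. x i * lorentz_sign i j) = x j * lorentz_sign j j"
    by simp
  have "(\<Sum>i\<in>UNIV. x i * lorentz_sign j i) = (\<Sum>i\<in>UNIV. if i = j then x i * lorentz_sign j i else 0)"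
    by (rule sum.cong) (auto simp: lorentz_sign_def)
  then show "(\<Sum>i\<in>UNIV. x i * lorentz_sign j i) = x j * lorentz_sign j j"
    by simp
qed

text \<open>The setting of a left-invariant orthonormal frame: constant metric coefficients and constant
  bracket coefficients make the components of all tensors derived from the metric constant.\<close>

locale homogeneous_frame = open_charts A for A :: "'a atlas" +
  fixes g :: "'a metric" and D :: "'a connection" and e :: "3 \<Rightarrow> 'a field"
    and c :: "3 \<Rightarrow> 3 \<Rightarrow> 3 \<Rightarrow> real"
  assumes metric: "lorentzian_metric A g"
    and levi_civita: "levi_civita_connection A g D"
    and frame_field: "e i \<in> vector_fields A"
    and orthonormal: "p \<in> points A \<Longrightarrow> g p (e i p) (e j p) = lorentz_sign i j"
    and structure_constants: "lie_bracket (e i) (e j) = (\<Sum>k\<in>UNIV. c i j k *\<^sub>R e k)"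
begin

definition coord :: "'a \<Rightarrow> 'a tangent \<Rightarrow> 3 \<Rightarrow> real" where
  "coord p v i = lorentz_sign i i * g p v (e i p)"

lemma frame_tangent: "p \<in> points A \<Longrightarrow> e i p \<in> tangent_space A p"
  by (rule vector_field_tangent[OF frame_field])

lemma metric_sym:
  "p \<in> points A \<Longrightarrow> u \<in> tangent_space A p \<Longrightarrow> v \<in> tangent_space A p \<Longrightarrow> g p u v = g p v u"
  using metric by (simp add: lorentzian_metric_def)

lemma metric_add:
  "p \<in> points A \<Longrightarrow> u \<in> tangent_space A p \<Longrightarrow> v \<in> tangent_space A p \<Longrightarrow> w \<in> tangent_space A p \<Longrightarrow>
    g p (u + v) w = g p u w + g p v w"
  using metric by (simp add: lorentzian_metric_def)

lemma metric_scale: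
  "p \<in> points A \<Longrightarrow> u \<in> tangent_space A p \<Longrightarrow> w \<in> tangent_space A p \<Longrightarrow>
    g p (a *\<^sub>R u) w = a * g p u w"
  using metric by (simp add: lorentzian_metric_def)

lemma metric_sum:
  assumes p: "p \<in> points A" and u: "\<And>i. i \<in> I \<Longrightarrow> u i \<in> tangent_space A p"
    and w: "w \<in> tangent_space A p"
  shows "g p (\<Sum>i\<in>I. a i *\<^sub>R u i) w = (\<Sum>i\<in>I. a i * g p (u i) w)"
  using u
proof (induction I rule: infinite_finite_induct)
  case (insert i I)
  have "a i *\<^sub>R u i \<in> tangent_space A p" "(\<Sum>i\<in>I. a i *\<^sub>R u i) \<in> tangent_space A p"
    using insert.prems by (auto intro!: subspace_scale subspace_sum subspace_tangent_space)
  then have "g p (\<Sum>i\<in>insert i I. a i *\<^sub>R u i) w = g p (a i *\<^sub>R u i) w + g p (\<Sum>i\<in>I. a i *\<^sub>R u i) w"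
    unfolding sum.insert[OF insert.hyps] by (rule metric_add[OF p _ _ w])
  then show ?case
    using insert p w by (simp add: metric_scale del: sum.insert) (simp add: insert.hyps)
qed (use metric_scale[OF p w w, of 0] in simp_all)

lemma metric_smooth:
  "X \<in> vector_fields A \<Longrightarrow> Y \<in> vector_fields A \<Longrightarrow> (\<lambda>p. g p (X p) (Y p)) \<in> smooth_functions A"
  using metric by (simp add: lorentzian_metric_def)

lemma coord_frame_sum:
  assumes "p \<in> points A"
  shows "coord p (\<Sum>i\<in>UNIV. a i *\<^sub>R e i p) j = a j"
  using assms by (simp add: coord_def metric_sum frame_tangent orthonormal)

lemma coord_frame: "p \<in> points A \<Longrightarrow> coord p (e i p) j = (if i = j then 1 else 0)"
  by (auto simp: coord_def orthonormal lorentz_sign_def)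

lemma frame_combination_tangent:
  "p \<in> points A \<Longrightarrow> (\<Sum>i\<in>I. a i *\<^sub>R e i p) \<in> tangent_space A p"
  by (auto intro!: subspace_scale subspace_sum subspace_tangent_space frame_tangent)

lemma coord_add:
  "p \<in> points A \<Longrightarrow> u \<in> tangent_space A p \<Longrightarrow> v \<in> tangent_space A p \<Longrightarrow>
    coord p (u + v) i = coord p u i + coord p v i"
  by (simp add: coord_def metric_add frame_tangent algebra_simps)

lemma coord_scale:
  "p \<in> points A \<Longrightarrow> u \<in> tangent_space A p \<Longrightarrow> coord p (a *\<^sub>R u) i = a * coord p u i"
  by (simp add: coord_def metric_scale frame_tangent)

lemma coord_sum:
  "p \<in> points A \<Longrightarrow> (\<And>i. i \<in> I \<Longrightarrow> u i \<in> tangent_space A p) \<Longrightarrow>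
    coord p (\<Sum>i\<in>I. a i *\<^sub>R u i) j = (\<Sum>i\<in>I. a i * coord p (u i) j)"
  by (simp add: coord_def metric_sum frame_tangent sum_distrib_left mult.left_commute)

lemma coord_smooth: "X \<in> vector_fields A \<Longrightarrow> (\<lambda>p. coord p (X p) i) \<in> smooth_functions A"
  unfolding coord_def by (intro smooth_cmult metric_smooth frame_field)

lemma inj_frame: "p \<in> points A \<Longrightarrow> inj (\<lambda>i. e i p)"
  by (rule injI) (metis coord_frame zero_neq_one)

text \<open>A vanishing combination has vanishing coordinates, and \<^const>\<open>coord\<close> recovers the coefficients
  of a combination by orthonormality.\<close>

lemma independent_frame:
  assumes p: "p \<in> points A"
  shows "independent (range (\<lambda>i. e i p))"
proof
  assume "dependent (range (\<lambda>i. e i p))"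
  then obtain a where "\<exists>v\<in>range (\<lambda>i. e i p). a v \<noteq> 0" and "(\<Sum>v\<in>range (\<lambda>i. e i p). a v *\<^sub>R v) = 0"
    by (auto simp: dependent_finite)
  then obtain j where j: "a (e j p) \<noteq> 0" and "(\<Sum>i\<in>UNIV. a (e i p) *\<^sub>R e i p) = 0"
    by (auto simp: sum.reindex[OF inj_frame[OF p]])
  then have "a (e j p) = coord p 0 j"
    using coord_frame_sum[OF p, of "\<lambda>i. a (e i p)" j] by simp
  moreover have "coord p 0 j = 0"
    using coord_frame_sum[OF p, of "\<lambda>_. 0" j] by simp
  ultimately show False
    using j by simp
qed

text \<open>The definition of a Lorentzian metric provides some frame \<open>b\<close> at \<open>p\<close>, so that more than three
  independent tangent vectors at \<open>p\<close> are impossible.\<close>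

lemma span_frame:
  assumes p: "p \<in> points A"
  shows "span (range (\<lambda>i. e i p)) = tangent_space A p"
proof (rule antisym)
  show "span (range (\<lambda>i. e i p)) \<subseteq> tangent_space A p"
    by (rule span_minimal) (auto simp: subspace_tangent_space frame_tangent p)
  obtain b where b: "is_frame (tangent_space A p) b"
    using metric p by (auto simp: lorentzian_metric_def)
  then have span_b: "span (range b) = tangent_space A p" and inj_b: "inj b"
    by (simp_all add: is_frame_def)
  show "tangent_space A p \<subseteq> span (range (\<lambda>i. e i p))"
  proof (rule subsetI, rule ccontr)
    fix v
    assume v: "v \<in> tangent_space A p" and "v \<notin> span (range (\<lambda>i. e i p))"
    then have ind: "independent (insert v (range (\<lambda>i. e i p)))" and "v \<notin> range (\<lambda>i. e i p)"
      using independent_frame[OF p] by (auto simp: independent_insert span_base)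
    then have "card (insert v (range (\<lambda>i. e i p))) = 4"
      by (simp add: card_image[OF inj_frame[OF p]])
    moreover have "insert v (range (\<lambda>i. e i p)) \<subseteq> span (range b)"
      using v frame_tangent[OF p] unfolding span_b by blast
    then have "card (insert v (range (\<lambda>i. e i p))) \<le> card (range b)"
      using independent_span_bound[OF finite_imageI[OF finite] ind] by blast
    moreover have "card (range b) = 3"
      by (simp add: card_image inj_b)
    ultimately show False
      by simp
  qed
qed

lemma frame_expansion:
  assumes "p \<in> points A" and "v \<in> tangent_space A p"
  shows "v = (\<Sum>i\<in>UNIV. coord p v i *\<^sub>R e i p)"
proof -
  obtain f where v: "v = (\<Sum>x\<in>range (\<lambda>i. e i p). f x *\<^sub>R x)"
    using assms span_frame by (auto simp: span_finite)
  then have v: "v = (\<Sum>i\<in>UNIV. f (e i p) *\<^sub>R e i p)"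
    by (simp add: sum.reindex inj_frame assms)
  then show ?thesis
    using coord_frame_sum[OF assms(1), of "\<lambda>i. f (e i p)"] by simp
qed

lemma metric_in_frame:
  assumes "p \<in> points A" and "u \<in> tangent_space A p" and "v \<in> tangent_space A p"
  shows "g p u v = (\<Sum>i\<in>UNIV. lorentz_sign i i * coord p u i * coord p v i)"
proof -
  have "g p u v = (\<Sum>i\<in>UNIV. coord p u i * g p (e i p) v)"
    by (subst frame_expansion[OF assms(1,2)]) (simp add: metric_sum assms frame_tangent)
  then show ?thesis
    using assms by (simp add: coord_def metric_sym[of p _ v] frame_tangent mult_ac)
qed

text \<open>The coefficients are global smooth functions (\<open>coord_smooth\<close>), so the frame generates the vector
  fields as a module over the smooth functions.\<close>

lemma field_expansion:
  assumes "X \<in> vector_fields A"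
  shows "X = (\<Sum>i\<in>UNIV. fmult (\<lambda>p. coord p (X p) i) (e i))"
proof
  fix p
  show "X p = (\<Sum>i\<in>UNIV. fmult (\<lambda>p. coord p (X p) i) (e i)) p"
  proof (cases "p \<in> points A")
    case True
    with frame_expansion[OF True vector_field_tangent[OF assms True]] show ?thesis
      by (simp add: sum_fun_apply fmult_apply)
  next
    case False
    then have "X p = 0" "e i p = 0" for i
      using assms frame_field[of i] by (auto simp: vector_fields_def)
    then show ?thesis
      by (simp add: sum_fun_apply fmult_apply)
  qed
qed

lemma tensorial_expansion:
  assumes F: "tensorial_at A p F" and X: "X \<in> vector_fields A"
  shows "F X = (\<Sum>i\<in>UNIV. coord p (X p) i *\<^sub>R F (e i))"
proof -
  let ?X = "\<lambda>i. fmult (\<lambda>p. coord p (X p) i) (e i)"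
  have f: "?X i \<in> vector_fields A" for i
    by (intro vector_field_fmult coord_smooth X frame_field)
  have "F X = F (\<Sum>i\<in>UNIV. ?X i)"
    using field_expansion[OF X] by simp
  also have "\<dots> = (\<Sum>i\<in>UNIV. F (?X i))"
    using F f by (simp add: sum_3 tensorial_at_def vector_field_add)
  also have "\<dots> = (\<Sum>i\<in>UNIV. coord p (X p) i *\<^sub>R F (e i))"
    using F by (simp add: tensorial_at_def frame_field coord_smooth X)
  finally show ?thesis .
qed

text \<open>A combination of the frame fields with constant coefficients takes any prescribed value at
  \<open>p\<close>, so the choice in \<^const>\<open>extension\<close> is from a nonempty set.\<close>

lemma extension:
  assumes "p \<in> points A" and "v \<in> tangent_space A p"
  shows "extension A p v \<in> vector_fields A" and "extension A p v p = v"
proof -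
  have "(\<Sum>i\<in>UNIV. coord p v i *\<^sub>R e i) \<in> vector_fields A"
    by (intro vector_field_sum vector_field_scaleR frame_field)
  moreover have "(\<Sum>i\<in>UNIV. coord p v i *\<^sub>R e i) p = v"
    using frame_expansion[OF assms] by (simp add: sum_fun_apply scaleR_fun_apply)
  ultimately have "\<exists>X. X \<in> vector_fields A \<and> X p = v"
    by blast
  from someI_ex[OF this] show "extension A p v \<in> vector_fields A" and "extension A p v p = v"
    by (simp_all add: extension_def)
qed


section \<open>The Levi-Civita connection in the frame\<close>

lemma D_field: "X \<in> vector_fields A \<Longrightarrow> Y \<in> vector_fields A \<Longrightarrow> D X Y \<in> vector_fields A"
  using levi_civita by (simp add: levi_civita_connection_def)

lemma D_add_left:
  "X \<in> vector_fields A \<Longrightarrow> X' \<in> vector_fields A \<Longrightarrow> Y \<in> vector_fields A \<Longrightarrow>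
    D (X + X') Y = D X Y + D X' Y"
  using levi_civita by (simp add: levi_civita_connection_def)

lemma D_fmult_left:
  "f \<in> smooth_functions A \<Longrightarrow> X \<in> vector_fields A \<Longrightarrow> Y \<in> vector_fields A \<Longrightarrow>
    D (fmult f X) Y = fmult f (D X Y)"
  using levi_civita by (simp add: levi_civita_connection_def)

lemma D_add_right:
  "X \<in> vector_fields A \<Longrightarrow> Y \<in> vector_fields A \<Longrightarrow> Y' \<in> vector_fields A \<Longrightarrow>
    D X (Y + Y') = D X Y + D X Y'"
  using levi_civita by (simp add: levi_civita_connection_def)

lemma D_fmult_right:
  "f \<in> smooth_functions A \<Longrightarrow> X \<in> vector_fields A \<Longrightarrow> Y \<in> vector_fields A \<Longrightarrow>
    D X (fmult f Y) = fmult (\<lambda>p. X p f) Y + fmult f (D X Y)"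
  using levi_civita by (simp add: levi_civita_connection_def)

lemma torsion_free:
  "X \<in> vector_fields A \<Longrightarrow> Y \<in> vector_fields A \<Longrightarrow> lie_bracket X Y = D X Y - D Y X"
  using levi_civita by (simp add: levi_civita_connection_def)

lemma metric_compatible:
  "X \<in> vector_fields A \<Longrightarrow> Y \<in> vector_fields A \<Longrightarrow> Z \<in> vector_fields A \<Longrightarrow> p \<in> points A \<Longrightarrow>
    X p (\<lambda>q. g q (Y q) (Z q)) = g p (D X Y p) (Z p) + g p (Y p) (D X Z p)"
  using levi_civita by (simp add: levi_civita_connection_def)

lemma D_scale_left:
  "X \<in> vector_fields A \<Longrightarrow> Y \<in> vector_fields A \<Longrightarrow> D (a *\<^sub>R X) Y = a *\<^sub>R D X Y"
  by (simp add: scaleR_eq_fmult D_fmult_left smooth_const)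

lemma D_scale_right:
  assumes "X \<in> vector_fields A" and "Y \<in> vector_fields A"
  shows "D X (a *\<^sub>R Y) = a *\<^sub>R D X Y"
proof -
  have "X p (\<lambda>_. a) = 0" for p
    using assms tangent_const[OF vector_field_tangent, of X p] by (cases "p \<in> points A") (auto simp: vector_fields_def)
  then have "fmult (\<lambda>p. X p (\<lambda>_. a)) Y = 0"
    by (simp add: fmult_def fun_eq_iff)
  then show ?thesis
    using assms by (simp add: scaleR_eq_fmult D_fmult_right smooth_const)
qed

lemma D_frame_sum_left:
  "Y \<in> vector_fields A \<Longrightarrow> D (\<Sum>i\<in>UNIV. a i *\<^sub>R e i) Y = (\<Sum>i\<in>UNIV. a i *\<^sub>R D (e i) Y)"
  by (simp add: sum_3 D_add_left D_scale_left vector_field_add vector_field_scaleR frame_field)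

lemma D_frame_sum_right:
  "X \<in> vector_fields A \<Longrightarrow> D X (\<Sum>i\<in>UNIV. a i *\<^sub>R e i) = (\<Sum>i\<in>UNIV. a i *\<^sub>R D X (e i))"
  by (simp add: sum_3 D_add_right D_scale_right vector_field_add vector_field_scaleR frame_field)

lemma lie_bracket_field:
  "X \<in> vector_fields A \<Longrightarrow> Y \<in> vector_fields A \<Longrightarrow> lie_bracket X Y \<in> vector_fields A"
  by (simp add: torsion_free vector_field_diff D_field)

text \<open>The Koszul formula. The products \<open>g(e\<^sub>j, e\<^sub>k)\<close> are constant on the manifold, so compatibility
  with the metric makes \<open>g(D e\<^sub>i e\<^sub>j, e\<^sub>k)\<close> skew in \<open>j\<close> and \<open>k\<close>; with the torsion equations for the
  three cyclic permutations of \<open>i\<close>, \<open>j\<close>, \<open>k\<close> this determines it.\<close>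

lemma D_frame: "D (e i) (e j) = (\<Sum>k\<in>UNIV. christoffel c i j k *\<^sub>R e k)"
proof
  fix p
  show "D (e i) (e j) p = (\<Sum>k\<in>UNIV. christoffel c i j k *\<^sub>R e k) p"
  proof (cases "p \<in> points A")
    case False
    then have "D (e i) (e j) p = 0" "e k p = 0" for k
      using frame_field[of k] D_field[OF frame_field frame_field, of i j]
      by (auto simp: vector_fields_def)
    then show ?thesis
      by (simp add: sum_fun_apply scaleR_fun_apply)
  next
    case p: True
    define \<Gamma> where "\<Gamma> = (\<lambda>i j k. g p (D (e i) (e j) p) (e k p))"
    have tan: "D (e i) (e j) p \<in> tangent_space A p" for i j
      by (intro vector_field_tangent D_field frame_field p)
    have skew: "\<Gamma> i j k + \<Gamma> i k j = 0" for i j k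
    proof -
      have "e i p (\<lambda>q. g q (e j q) (e k q)) = e i p (\<lambda>_. lorentz_sign j k)"
        by (rule tangent_cong[OF frame_tangent p])
          (auto simp: p orthonormal intro: metric_smooth frame_field)
      also have "\<dots> = 0"
        by (rule tangent_const[OF frame_tangent[OF p]])
      finally show ?thesis
        using p by (simp add: metric_compatible frame_field \<Gamma>_def metric_sym[of p "e j p"] tan frame_tangent)
    qed
    have tor: "\<Gamma> i j k = c i j k * lorentz_sign k k + \<Gamma> j i k" for i j k
    proof -
      have "D (e i) (e j) p = (\<Sum>k\<in>UNIV. c i j k *\<^sub>R e k p) + D (e j) (e i) p"
        using torsion_free[OF frame_field frame_field, of i j] structure_constants[of i j]
        by (metis (no_types, lifting) diff_add_cancel plus_fun_apply sum_fun_apply scaleR_fun_apply sum.cong)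
      then show ?thesis
        using p by (simp add: \<Gamma>_def metric_add metric_sum frame_combination_tangent tan frame_tangent orthonormal)
    qed
    have koszul: "2 * \<Gamma> i j k = c i j k * lorentz_sign k k - c j k i * lorentz_sign i i
        + c k i j * lorentz_sign j j" for i j k
      using tor[of i j k] tor[of j k i] tor[of k i j] skew[of i j k] skew[of j k i] skew[of k i j]
      by linarith
    have coords: "coord p (D (e i) (e j) p) k = christoffel c i j k" for k
      unfolding christoffel_def by (simp only: koszul[symmetric]) (simp add: coord_def \<Gamma>_def)
    have "D (e i) (e j) p = (\<Sum>k\<in>UNIV. coord p (D (e i) (e j) p) k *\<^sub>R e k p)"
      by (rule frame_expansion[OF p tan])
    also have "\<dots> = (\<Sum>k\<in>UNIV. christoffel c i j k *\<^sub>R e k) p"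
      by (simp add: coords sum_fun_apply scaleR_fun_apply)
    finally show ?thesis .
  qed
qed


section \<open>Curvature\<close>

lemma bracket_add_left:
  "X \<in> vector_fields A \<Longrightarrow> X' \<in> vector_fields A \<Longrightarrow> Y \<in> vector_fields A \<Longrightarrow>
    lie_bracket (X + X') Y = lie_bracket X Y + lie_bracket X' Y"
  by (simp add: torsion_free vector_field_add D_add_left D_add_right)

lemma bracket_fmult_left:
  "f \<in> smooth_functions A \<Longrightarrow> X \<in> vector_fields A \<Longrightarrow> Y \<in> vector_fields A \<Longrightarrow>
    lie_bracket (fmult f X) Y = fmult f (lie_bracket X Y) + fmult (\<lambda>p. - Y p f) X"
  by (rule ext)
    (simp add: torsion_free vector_field_fmult D_fmult_left D_fmult_right fmult_apply algebra_simps)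

lemma curvature_field:
  "X \<in> vector_fields A \<Longrightarrow> Y \<in> vector_fields A \<Longrightarrow> Z \<in> vector_fields A \<Longrightarrow>
    curvature D X Y Z \<in> vector_fields A"
  unfolding curvature_def by (intro vector_field_diff D_field lie_bracket_field)

text \<open>In each of the three arguments the derivatives of a factor \<open>f\<close> cancel: in the first two, the
  term from the bracket against the one from the Leibniz rule for \<open>D\<close>; in the third, because
  \<open>[X, Y] f = X (Y f) - Y (X f)\<close>.\<close>

lemma curvature_tensorial_1:
  assumes "Y \<in> vector_fields A" and "Z \<in> vector_fields A"
  shows "tensorial_at A p (\<lambda>X. curvature D X Y Z p)"
  unfolding tensorial_at_def
proof (intro conjI ballI)
  fix X X'
  assume "X \<in> vector_fields A" "X' \<in> vector_fields A"
  with assms show "curvature D (X + X') Y Z p = curvature D X Y Z p + curvature D X' Y Z p"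
    by (simp add: curvature_def bracket_add_left D_add_left D_add_right D_field lie_bracket_field
        vector_field_add)
next
  fix f X
  assume f: "f \<in> smooth_functions A" and X: "X \<in> vector_fields A"
  have "(\<lambda>p. - Y p f) \<in> smooth_functions A"
    using smooth_cmult[OF vector_field_smooth[OF assms(1) f], of "-1"] by simp
  with f X assms show "curvature D (fmult f X) Y Z p = f p *\<^sub>R curvature D X Y Z p"
    by (simp add: curvature_def bracket_fmult_left D_add_left D_fmult_left D_fmult_right D_field
        lie_bracket_field vector_field_fmult fmult_apply algebra_simps)
qed

lemma curvature_skew:
  assumes "X \<in> vector_fields A" and "Y \<in> vector_fields A" and "Z \<in> vector_fields A"
  shows "curvature D Y X Z p = - curvature D X Y Z p"
proof -
  have "lie_bracket Y X = (-1) *\<^sub>R lie_bracket X Y"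
    by (auto simp: lie_bracket_def scaleR_fun_def fun_eq_iff)
  then show ?thesis
    using assms D_scale_left[of "lie_bracket X Y" Z "-1"] by (simp add: curvature_def lie_bracket_field)
qed

lemma curvature_tensorial_2:
  assumes "X \<in> vector_fields A" and "Z \<in> vector_fields A"
  shows "tensorial_at A p (\<lambda>Y. curvature D X Y Z p)"
  using curvature_tensorial_1[OF assms, of p] assms
  by (simp add: tensorial_at_def curvature_skew[OF _ assms(1,2)] vector_field_add vector_field_fmult)

lemma curvature_tensorial_3:
  assumes "X \<in> vector_fields A" and "Y \<in> vector_fields A"
  shows "tensorial_at A p (\<lambda>Z. curvature D X Y Z p)"
  unfolding tensorial_at_def
proof (intro conjI ballI)
  fix Z Z'
  assume "Z \<in> vector_fields A" "Z' \<in> vector_fields A"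
  with assms show "curvature D X Y (Z + Z') p = curvature D X Y Z p + curvature D X Y Z' p"
    by (simp add: curvature_def D_add_right D_field lie_bracket_field)
next
  fix f Z
  assume f: "f \<in> smooth_functions A" and "Z \<in> vector_fields A"
  with assms show "curvature D X Y (fmult f Z) p = f p *\<^sub>R curvature D X Y Z p"
    by (simp add: curvature_def D_add_right D_fmult_right D_field lie_bracket_field vector_field_fmult
        vector_field_smooth fmult_apply algebra_simps) (simp add: lie_bracket_def algebra_simps)
qed

end

text \<open>The coefficient of \<open>e\<^sub>l\<close> in \<open>R(e\<^sub>i, e\<^sub>j) e\<^sub>k\<close>, in the sign convention of \<^const>\<open>curvature\<close>. The
  arrays that follow are likewise the components of the tensors they are named after.\<close>

definition frame_curvature :: "(3 \<Rightarrow> 3 \<Rightarrow> 3 \<Rightarrow> real) \<Rightarrow> 3 \<Rightarrow> 3 \<Rightarrow> 3 \<Rightarrow> 3 \<Rightarrow> real" where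
  "frame_curvature c i j k l = (\<Sum>m\<in>UNIV. c i j m * christoffel c m k l
     - christoffel c j k m * christoffel c i m l + christoffel c i k m * christoffel c j m l)"

definition frame_ricci :: "(3 \<Rightarrow> 3 \<Rightarrow> 3 \<Rightarrow> real) \<Rightarrow> 3 \<Rightarrow> 3 \<Rightarrow> real" where
  "frame_ricci c i j = (\<Sum>k\<in>UNIV. frame_curvature c i k j k)"

definition frame_schouten :: "(3 \<Rightarrow> 3 \<Rightarrow> 3 \<Rightarrow> real) \<Rightarrow> 3 \<Rightarrow> 3 \<Rightarrow> real" where
  "frame_schouten c i j =
     frame_ricci c i j - (\<Sum>k\<in>UNIV. lorentz_sign k k * frame_ricci c k k) / 4 * lorentz_sign i j"

context homogeneous_frame
begin

lemma curvature_frame: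
  "curvature D (e i) (e j) (e k) = (\<Sum>l\<in>UNIV. frame_curvature c i j k l *\<^sub>R e l)"
  by (simp add: curvature_def structure_constants D_frame D_frame_sum_left D_frame_sum_right frame_field)
    (simp add: frame_curvature_def sum_3 algebra_simps)

lemma coord_curvature:
  assumes p: "p \<in> points A" and X: "X \<in> vector_fields A" and Z: "Z \<in> vector_fields A"
  shows "coord p (curvature D X (e j) Z p) l
    = (\<Sum>i\<in>UNIV. \<Sum>k\<in>UNIV. coord p (X p) i * coord p (Z p) k * frame_curvature c i j k l)"
proof -
  have "curvature D X (e j) Z p = (\<Sum>i\<in>UNIV. coord p (X p) i *\<^sub>R curvature D (e i) (e j) Z p)"
    by (rule tensorial_expansion[OF curvature_tensorial_1 X]) (intro frame_field Z)+
  moreover have "curvature D (e i) (e j) Z p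
      = (\<Sum>k\<in>UNIV. coord p (Z p) k *\<^sub>R curvature D (e i) (e j) (e k) p)" for i
    by (rule tensorial_expansion[OF curvature_tensorial_3 Z]) (intro frame_field)+
  moreover have "curvature D (e i) (e j) Z p \<in> tangent_space A p"
    "curvature D (e i) (e j) (e k) p \<in> tangent_space A p" for i k
    by (intro vector_field_tangent curvature_field frame_field Z p)+
  moreover have "coord p (curvature D (e i) (e j) (e k) p) l = frame_curvature c i j k l" for i k
    using p by (simp add: curvature_frame sum_fun_apply scaleR_fun_apply coord_frame_sum)
  ultimately show ?thesis
    using p by (simp add: coord_sum sum_distrib_left mult.assoc)
qed

text \<open>The basis in \<^const>\<open>trace_on\<close> is an arbitrary one and cancels: writing \<open>L w = \<Sum> w\<^sub>j r\<^sub>j\<close>, the sum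
  over the basis \<open>B\<close> reassembles \<open>r\<^sub>j\<close> from its own \<open>B\<close>-expansion before its \<open>j\<close>-th coordinate is
  taken. The hypothesis on \<open>L\<close> says that it is linear on the tangent space.\<close>

lemma trace_in_frame:
  assumes p: "p \<in> points A" and r: "\<And>j. r j \<in> tangent_space A p"
    and L: "\<And>w. w \<in> tangent_space A p \<Longrightarrow> L w = (\<Sum>j\<in>UNIV. coord p w j *\<^sub>R r j)"
  shows "trace_on (tangent_space A p) L = (\<Sum>j\<in>UNIV. coord p (r j) j)"
proof -
  define B where "B = (SOME B. independent B \<and> span B = tangent_space A p)"
  have B: "independent B" "span B = tangent_space A p"
    using someI[of "\<lambda>B. independent B \<and> span B = tangent_space A p", OF conjI[OF independent_frame[OF p] span_frame[OF p]]]
    by (simp_all add: B_def)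
  have BT: "B \<subseteq> tangent_space A p"
    unfolding B(2)[symmetric] by (rule span_superset)
  then have "finite B"
    using independent_span_bound[OF _ B(1), of "range (\<lambda>i. e i p)"] span_frame[OF p] by simp
  have "trace_on (tangent_space A p) L = (\<Sum>b\<in>B. representation B (L b) b)"
    by (simp add: trace_on_def B_def Let_def)
  also have "\<dots> = (\<Sum>b\<in>B. \<Sum>j\<in>UNIV. coord p b j * representation B (r j) b)"
  proof (rule sum.cong[OF refl])
    fix b
    assume "b \<in> B"
    with BT L have "L b = (\<Sum>j\<in>UNIV. coord p b j *\<^sub>R r j)"
      by blast
    then show "representation B (L b) b = (\<Sum>j\<in>UNIV. coord p b j * representation B (r j) b)"
      using r by (simp add: representation_sum representation_scale B span_scale
          subspace_scale subspace_tangent_space)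
  qed
  also have "\<dots> = (\<Sum>j\<in>UNIV. \<Sum>b\<in>B. representation B (r j) b * coord p b j)"
    by (subst sum.swap) (simp add: mult.commute)
  also have "\<dots> = (\<Sum>j\<in>UNIV. coord p (\<Sum>b\<in>B. representation B (r j) b *\<^sub>R b) j)"
    using BT by (subst coord_sum[OF p]) auto
  also have "\<dots> = (\<Sum>j\<in>UNIV. coord p (r j) j)"
    using r B \<open>finite B\<close> by (simp add: sum_representation_eq)
  finally show ?thesis .
qed

lemma ricci_in_frame:
  assumes p: "p \<in> points A" and u: "u \<in> tangent_space A p" and v: "v \<in> tangent_space A p"
  shows "ricci A D p u v = (\<Sum>i\<in>UNIV. \<Sum>j\<in>UNIV. coord p u i * coord p v j * frame_ricci c i j)"
proof -
  let ?U = "extension A p u" and ?V = "extension A p v"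
  let ?r = "\<lambda>j. curvature D ?U (e j) ?V p"
  have "ricci A D p u v = (\<Sum>j\<in>UNIV. coord p (?r j) j)"
    unfolding ricci_def
  proof (rule trace_in_frame[OF p])
    show "?r j \<in> tangent_space A p" for j
      by (intro vector_field_tangent curvature_field frame_field extension u v p)
    fix w
    assume w: "w \<in> tangent_space A p"
    show "curvature D ?U (extension A p w) ?V p = (\<Sum>j\<in>UNIV. coord p w j *\<^sub>R ?r j)"
      using tensorial_expansion[OF curvature_tensorial_2 extension(1)[OF p w], of ?U ?V]
        extension[OF p u] extension[OF p v] extension[OF p w] by simp
  qed
  also have "\<dots> = (\<Sum>k\<in>UNIV. \<Sum>i\<in>UNIV. \<Sum>j\<in>UNIV. coord p u i * coord p v j * frame_curvature c i k j k)"
    using extension[OF p u] extension[OF p v] by (simp add: coord_curvature p)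
  also have "\<dots> = (\<Sum>i\<in>UNIV. \<Sum>j\<in>UNIV. coord p u i * coord p v j * frame_ricci c i j)"
    by (simp add: frame_ricci_def sum_3 algebra_simps)
  finally show ?thesis .
qed

text \<open>Row \<open>i\<close> consists of the coordinates of \<open>b i\<close>, so that the change from \<open>e\<close> to \<open>b\<close> multiplies
  the component array of a bilinear form by this matrix on the left and by its transpose on the right.\<close>

definition frame_matrix :: "'a \<Rightarrow> (3 \<Rightarrow> 'a tangent) \<Rightarrow> real^3^3" where
  "frame_matrix p b = (\<chi> i a. coord p (b i) a)"

end

abbreviation lorentz_matrix :: "real^3^3" where
  "lorentz_matrix \<equiv> (\<chi> i j. lorentz_sign i j)"

lemma matrix_inv_eqI:
  fixes M N :: "real^'n^'n"
  assumes "M ** N = mat 1"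
  shows "matrix_inv M = N"
proof -
  have "M ** N = mat 1 \<and> N ** M = mat 1"
    using assms by (simp add: matrix_left_right_inverse)
  then have "M ** matrix_inv M = mat 1 \<and> matrix_inv M ** M = mat 1"
    unfolding matrix_inv_def by (rule someI)
  then show ?thesis
    using assms by (metis matrix_mul_assoc matrix_mul_lid matrix_mul_rid)
qed

lemma lorentz_matrix_square: "lorentz_matrix ** lorentz_matrix = mat 1"
  by (simp add: matrix_matrix_mult_def mat_def vec_eq_iff) (simp add: lorentz_sign_def)

lemma det_lorentz_matrix: "det lorentz_matrix = -1"
  by (simp add: det_3 lorentz_sign_def)

context homogeneous_frame
begin

lemma frame_tangent_space:
  "is_frame (tangent_space A p) b \<Longrightarrow> b i \<in> tangent_space A p"
  by (metis is_frame_def rangeI span_superset subsetD)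

lemma frame_matrix_left_inverse:
  assumes p: "p \<in> points A" and b: "is_frame (tangent_space A p) b"
  obtains Q where "Q ** frame_matrix p b = mat 1"
proof -
  have "span (range b) = tangent_space A p" "inj b"
    using b by (simp_all add: is_frame_def)
  then have "\<exists>q. e a p = (\<Sum>i\<in>UNIV. q i *\<^sub>R b i)" for a
    using frame_tangent[OF p, of a] by (auto simp: span_finite sum.reindex)
  then obtain q where q: "\<And>a. e a p = (\<Sum>i\<in>UNIV. q a i *\<^sub>R b i)"
    by metis
  have "(\<Sum>i\<in>UNIV. q a i * coord p (b i) k) = (if a = k then 1 else 0)" for a k
    using coord_frame[OF p, of a k] coord_sum[OF p, where I = UNIV and u = b and a = "q a" and j = k]
      frame_tangent_space[OF b]
    by (simp add: q[symmetric])
  then have "(\<chi> a i. q a i) ** frame_matrix p b = mat 1"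
    by (simp add: matrix_matrix_mult_def mat_def vec_eq_iff frame_matrix_def)
  then show thesis
    by (rule that)
qed

lemma gram_frame:
  assumes p: "p \<in> points A" and b: "is_frame (tangent_space A p) b"
  shows "gram (g p) b = frame_matrix p b ** lorentz_matrix ** transpose (frame_matrix p b)"
  by (simp add: vec_eq_iff gram_def matrix_matrix_mult_def transpose_def frame_matrix_def
      metric_in_frame[OF p] frame_tangent_space[OF b]) (simp add: mult_ac)

text \<open>For the matrix \<open>P\<close> of the chosen frame, the Gram matrix is \<open>P H P\<^sup>T\<close> and the Ricci components are
  \<open>P r P\<^sup>T\<close>, where \<open>H\<close> is the Lorentzian sign matrix and \<open>r\<close> the array of Ricci components in \<open>e\<close>.
  With \<open>Q = P\<^sup>-\<^sup>1\<close> the inverse Gram matrix is \<open>Q\<^sup>T H Q\<close>, and the contraction is the trace of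
  \<open>Q\<^sup>T H Q P r P\<^sup>T\<close>, which is that of \<open>H r\<close>.\<close>

lemma scalar_curvature_frame:
  assumes p: "p \<in> points A"
  shows "scalar_curvature A g D p = (\<Sum>k\<in>UNIV. lorentz_sign k k * frame_ricci c k k)"
proof -
  define b where "b = (SOME b. is_frame (tangent_space A p) b)"
  have b: "is_frame (tangent_space A p) b"
    unfolding b_def by (rule someI[of _ "\<lambda>i. e i p"])
      (simp add: is_frame_def inj_frame independent_frame span_frame p)
  let ?P = "frame_matrix p b" and ?H = lorentz_matrix
  obtain Q where Q: "Q ** ?P = mat 1"
    using frame_matrix_left_inverse[OF p b] .
  then have Q': "?P ** Q = mat 1"
    by (simp add: matrix_left_right_inverse)
  have QT: "transpose ?P ** transpose Q = mat 1"
    by (simp add: Q flip: matrix_transpose_mul)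
  let ?N = "transpose Q ** ?H ** Q"
  have H2: "?H ** (?H ** X) = X" for X
    by (simp add: matrix_mul_assoc lorentz_matrix_square)
  have PT2: "transpose ?P ** (transpose Q ** X) = X" for X :: "real^3^3"
    by (simp add: matrix_mul_assoc QT)
  have "gram (g p) b ** ?N = mat 1"
    by (simp add: gram_frame[OF p b] H2 PT2 Q' flip: matrix_mul_assoc)
  then have inv: "matrix_inv (gram (g p) b) = ?N"
    by (rule matrix_inv_eqI)
  let ?M = "?P ** (\<chi> i j. frame_ricci c i j) ** transpose ?P"
  have M: "ricci A D p (b i) (b j) = ?M $ i $ j" for i j
    by (simp add: matrix_matrix_mult_def transpose_def frame_matrix_def ricci_in_frame[OF p]
        frame_tangent_space[OF b] sum_3 algebra_simps)
  have "scalar_curvature A g D p = (\<Sum>i\<in>UNIV. \<Sum>j\<in>UNIV. ?N $ i $ j * ?M $ i $ j)"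
    unfolding scalar_curvature_def Let_def b_def[symmetric] inv M ..
  also have "\<dots> = (\<Sum>j\<in>UNIV. \<Sum>i\<in>UNIV. ?N $ i $ j * ?M $ i $ j)"
    by (rule sum.swap)
  also have "\<dots> = trace (transpose ?N ** ?M)"
    by (simp add: trace_def matrix_matrix_mult_def transpose_def)
  also have "transpose ?N = ?N"
  proof -
    have "transpose ?H = ?H"
      by (simp add: transpose_def vec_eq_iff lorentz_sign_def)
    then show ?thesis
      by (simp add: matrix_transpose_mul matrix_mul_assoc)
  qed
  also have "trace (?N ** ?M) = trace (transpose Q ** (?H ** (\<chi> i j. frame_ricci c i j) ** transpose ?P))"
  proof -
    have "Q ** (?P ** X) = X" for X :: "real^3^3"
      by (simp add: matrix_mul_assoc Q)
    then show ?thesis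
      by (simp flip: matrix_mul_assoc)
  qed
  also have "\<dots> = trace (?H ** (\<chi> i j. frame_ricci c i j))"
    by (subst trace_mul_sym) (simp add: QT flip: matrix_mul_assoc)
  also have "\<dots> = (\<Sum>k\<in>UNIV. lorentz_sign k k * frame_ricci c k k)"
    by (simp add: trace_def matrix_matrix_mult_def sum_3 lorentz_sign_def)
  finally show ?thesis .
qed

lemma schouten_in_frame:
  assumes "p \<in> points A" and "u \<in> tangent_space A p" and "v \<in> tangent_space A p"
  shows "schouten A g D p u v = (\<Sum>i\<in>UNIV. \<Sum>j\<in>UNIV. coord p u i * coord p v j * frame_schouten c i j)"
  using assms
  by (simp add: schouten_def ricci_in_frame scalar_curvature_frame metric_in_frame frame_schouten_def
      sum_3 lorentz_sign_def field_simps)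

end


section \<open>The Cotton tensor\<close>

text \<open>There is no term with derivatives of the components \<open>s\<close>, because these are constant.\<close>

definition frame_covariant_derivative ::
  "(3 \<Rightarrow> 3 \<Rightarrow> 3 \<Rightarrow> real) \<Rightarrow> (3 \<Rightarrow> 3 \<Rightarrow> real) \<Rightarrow> 3 \<Rightarrow> 3 \<Rightarrow> 3 \<Rightarrow> real" where
  "frame_covariant_derivative c s i j k =
     (\<Sum>m\<in>UNIV. - (christoffel c i j m * s m k) - christoffel c i k m * s j m)"

definition frame_cotton_03 :: "(3 \<Rightarrow> 3 \<Rightarrow> 3 \<Rightarrow> real) \<Rightarrow> 3 \<Rightarrow> 3 \<Rightarrow> 3 \<Rightarrow> real" where
  "frame_cotton_03 c i j k = frame_covariant_derivative c (frame_schouten c) i j k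
     - frame_covariant_derivative c (frame_schouten c) j i k"

definition frame_cotton :: "(3 \<Rightarrow> 3 \<Rightarrow> 3 \<Rightarrow> real) \<Rightarrow> 3 \<Rightarrow> 3 \<Rightarrow> real" where
  "frame_cotton c i j = (\<Sum>n\<in>UNIV. \<Sum>m\<in>UNIV.
     frame_cotton_03 c n m i * levi_civita_symbol n m j * lorentz_sign j j) / 2"

context homogeneous_frame
begin

definition has_components :: "'a metric \<Rightarrow> (3 \<Rightarrow> 3 \<Rightarrow> real) \<Rightarrow> bool" where
  "has_components S s \<longleftrightarrow> (\<forall>p\<in>points A. \<forall>u\<in>tangent_space A p. \<forall>v\<in>tangent_space A p.
     S p u v = (\<Sum>i\<in>UNIV. \<Sum>j\<in>UNIV. coord p u i * coord p v j * s i j))"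

lemma components:
  "has_components S s \<Longrightarrow> p \<in> points A \<Longrightarrow> u \<in> tangent_space A p \<Longrightarrow> v \<in> tangent_space A p \<Longrightarrow>
    S p u v = (\<Sum>i\<in>UNIV. \<Sum>j\<in>UNIV. coord p u i * coord p v j * s i j)"
  by (simp add: has_components_def)

text \<open>Exchanging the arguments of a tensor is used to carry statements about its first argument over
  to the second.\<close>

lemma components_flip:
  assumes "has_components S s"
  shows "has_components (\<lambda>p u v. S p v u) (\<lambda>i j. s j i)"
  unfolding has_components_def
proof (intro ballI)
  fix p u v
  assume "p \<in> points A" "u \<in> tangent_space A p" "v \<in> tangent_space A p"
  then show "S p v u = (\<Sum>i\<in>UNIV. \<Sum>j\<in>UNIV. coord p u i * coord p v j * s j i)"
    by (subst sum.swap) (simp add: components[OF assms] mult.commute mult.left_commute)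
qed

lemma components_add:
  assumes "has_components S s" and "p \<in> points A" and "u \<in> tangent_space A p"
    and "u' \<in> tangent_space A p" and "v \<in> tangent_space A p"
  shows "S p (u + u') v = S p u v + S p u' v"
proof -
  have "u + u' \<in> tangent_space A p"
    by (intro subspace_add subspace_tangent_space assms)
  then show ?thesis
    using assms by (simp add: components[OF assms(1)] coord_add algebra_simps sum.distrib)
qed

lemma components_scale:
  assumes "has_components S s" and "p \<in> points A" and "u \<in> tangent_space A p"
    and "v \<in> tangent_space A p"
  shows "S p (a *\<^sub>R u) v = a * S p u v"
proof -
  have "a *\<^sub>R u \<in> tangent_space A p"
    by (intro subspace_scale subspace_tangent_space assms)
  then show ?thesis
    using assms by (simp add: components[OF assms(1)] coord_scale sum_distrib_left mult.assoc)
qed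

lemma components_smooth:
  assumes S: "has_components S s" and Y: "Y \<in> vector_fields A" and Z: "Z \<in> vector_fields A"
  shows "(\<lambda>q. S q (Y q) (Z q)) \<in> smooth_functions A"
proof (rule smooth_cong)
  show "(\<lambda>q. \<Sum>i\<in>UNIV. \<Sum>j\<in>UNIV. coord q (Y q) i * coord q (Z q) j * s i j) \<in> smooth_functions A"
    by (intro smooth_sum smooth_mult smooth_const coord_smooth Y Z)
  show "(\<Sum>i\<in>UNIV. \<Sum>j\<in>UNIV. coord q (Y q) i * coord q (Z q) j * s i j) = S q (Y q) (Z q)"
    if "q \<in> points A" for q
    using that by (simp add: components[OF S] vector_field_tangent Y Z)
qed

text \<open>The field \<open>X\<close> along which the derivative is taken enters through its value at \<open>p\<close> and through
  \<open>D X\<close>, which is function-linear in \<open>X\<close>. In the other two arguments the Leibniz term \<open>(X f) S(Y, Z)\<close>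
  cancels against the one from \<open>D X (f Y)\<close>.\<close>

lemma covariant_derivative_tensorial_1:
  assumes S: "has_components S s" and "p \<in> points A" and Y: "Y \<in> vector_fields A"
    and Z: "Z \<in> vector_fields A"
  shows "tensorial_at A p (\<lambda>X. covariant_derivative D S X Y Z p)"
proof -
  have add: "S p u (v + v') = S p u v + S p u v'"
    if "u \<in> tangent_space A p" "v \<in> tangent_space A p" "v' \<in> tangent_space A p" for u v v'
    using components_add[OF components_flip[OF S] \<open>p \<in> points A\<close>] that by blast
  have scale: "S p u (a *\<^sub>R v) = a * S p u v"
    if "u \<in> tangent_space A p" "v \<in> tangent_space A p" for u v a
    using components_scale[OF components_flip[OF S] \<open>p \<in> points A\<close>] that by blast
  show ?thesis
    unfolding tensorial_at_def
    using assms by (auto simp: covariant_derivative_def D_add_left D_fmult_left D_field fmult_apply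
        scaleR_fun_apply components_add[OF S] components_scale[OF S] add scale vector_field_tangent algebra_simps)
qed

lemma covariant_derivative_tensorial_2:
  assumes S: "has_components S s" and p: "p \<in> points A" and X: "X \<in> vector_fields A"
    and Z: "Z \<in> vector_fields A"
  shows "tensorial_at A p (\<lambda>Y. covariant_derivative D S X Y Z p)"
proof -
  have tangent: "W q \<in> tangent_space A q" if "W \<in> vector_fields A" "q \<in> points A" for W q
    using that by (rule vector_field_tangent)
  have DX: "D X W q \<in> tangent_space A q" if "W \<in> vector_fields A" "q \<in> points A" for W q
    using that X by (intro vector_field_tangent D_field)
  show ?thesis
    unfolding tensorial_at_def
  proof (intro conjI ballI)
    fix Y Y'
    assume Y: "Y \<in> vector_fields A" and Y': "Y' \<in> vector_fields A"
    have "X p (\<lambda>q. S q ((Y + Y') q) (Z q)) = X p (\<lambda>q. S q (Y q) (Z q) + S q (Y' q) (Z q))"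
      by (rule tangent_cong[OF tangent[OF X p] p components_smooth[OF S vector_field_add[OF Y Y'] Z]])
        (simp add: components_add[OF S] tangent Y Y' Z)
    then show "covariant_derivative D S X (Y + Y') Z p
        = covariant_derivative D S X Y Z p + covariant_derivative D S X Y' Z p"
      using p by (simp add: covariant_derivative_def tangent_add[OF tangent[OF X p]]
          components_smooth[OF S] D_add_right components_add[OF S] tangent DX X Y Y' Z)
  next
    fix f Y
    assume f: "f \<in> smooth_functions A" and Y: "Y \<in> vector_fields A"
    have "X p (\<lambda>q. S q (fmult f Y q) (Z q)) = X p (\<lambda>q. f q * S q (Y q) (Z q))"
      by (rule tangent_cong[OF tangent[OF X p] p components_smooth[OF S vector_field_fmult[OF f Y] Z]])
        (simp add: fmult_apply components_scale[OF S] tangent Y Z)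
    moreover have "a *\<^sub>R Y p \<in> tangent_space A p" "a *\<^sub>R D X Y p \<in> tangent_space A p" for a
      by (rule subspace_scale[OF subspace_tangent_space tangent[OF Y p]],
          rule subspace_scale[OF subspace_tangent_space DX[OF Y p]])
    ultimately show "covariant_derivative D S X (fmult f Y) Z p = f p *\<^sub>R covariant_derivative D S X Y Z p"
      using p by (simp add: covariant_derivative_def tangent_mult[OF tangent[OF X p] f]
          components_smooth[OF S] D_fmult_right components_add[OF S] components_scale[OF S] fmult_apply
          tangent DX X Y Z f algebra_simps)
  qed
qed

lemma covariant_derivative_flip:
  "covariant_derivative D (\<lambda>p u v. S p v u) X Y Z p = covariant_derivative D S X Z Y p"
  by (simp add: covariant_derivative_def)

lemma covariant_derivative_tensorial_3:
  assumes "has_components S s" and "p \<in> points A" and "X \<in> vector_fields A" and "Y \<in> vector_fields A"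
  shows "tensorial_at A p (\<lambda>Z. covariant_derivative D S X Y Z p)"
  using covariant_derivative_tensorial_2[OF components_flip[OF assms(1)] assms(2-4)]
  by (simp only: covariant_derivative_flip[of S])

lemma covariant_derivative_frame:
  assumes S: "has_components S s" and p: "p \<in> points A"
  shows "covariant_derivative D S (e i) (e j) (e k) p = frame_covariant_derivative c s i j k"
proof -
  have D_tangent: "D (e i) (e j) p \<in> tangent_space A p" for i j
    by (intro vector_field_tangent D_field frame_field p)
  have D_coord: "coord p (D (e i) (e j) p) m = christoffel c i j m" for i j m
    using p by (simp add: D_frame sum_fun_apply scaleR_fun_apply coord_frame_sum)
  have S_frame: "S q (e j q) (e k q) = s j k" if "q \<in> points A" for q j k
    using that exhaust_3[of j] exhaust_3[of k]
    by (auto simp: components[OF S] frame_tangent coord_frame sum_3)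
  have "e i p (\<lambda>q. S q (e j q) (e k q)) = e i p (\<lambda>_. s j k)"
    by (rule tangent_cong[OF frame_tangent[OF p] p components_smooth[OF S frame_field frame_field] S_frame])
  also have "\<dots> = 0"
    by (rule tangent_const[OF frame_tangent[OF p]])
  finally have "e i p (\<lambda>q. S q (e j q) (e k q)) = 0" .
  moreover have "S p (D (e i) (e j) p) (e k p) = (\<Sum>m\<in>UNIV. christoffel c i j m * s m k)"
    for i j k
    using p exhaust_3[of k]
    by (auto simp: components[OF S] D_tangent D_coord frame_tangent coord_frame sum_3)
  moreover have "S p (e j p) (D (e i) (e k) p) = (\<Sum>m\<in>UNIV. christoffel c i k m * s j m)"
    for i j k
    using p exhaust_3[of j]
    by (auto simp: components[OF S] D_tangent D_coord frame_tangent coord_frame sum_3)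
  ultimately show ?thesis
    by (simp add: covariant_derivative_def frame_covariant_derivative_def sum_subtractf sum_negf)
qed

lemma covariant_derivative_in_frame:
  assumes S: "has_components S s" and p: "p \<in> points A" and X: "X \<in> vector_fields A"
    and Y: "Y \<in> vector_fields A" and Z: "Z \<in> vector_fields A"
  shows "covariant_derivative D S X Y Z p = (\<Sum>i\<in>UNIV. \<Sum>j\<in>UNIV. \<Sum>k\<in>UNIV.
    coord p (X p) i * coord p (Y p) j * coord p (Z p) k * frame_covariant_derivative c s i j k)"
proof -
  have "covariant_derivative D S X Y Z p
      = (\<Sum>i\<in>UNIV. coord p (X p) i * covariant_derivative D S (e i) Y Z p)"
    using tensorial_expansion[OF covariant_derivative_tensorial_1[OF S p Y Z] X] by simp
  moreover have "covariant_derivative D S (e i) Y Z p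
      = (\<Sum>j\<in>UNIV. coord p (Y p) j * covariant_derivative D S (e i) (e j) Z p)" for i
    using tensorial_expansion[OF covariant_derivative_tensorial_2[OF S p frame_field Z] Y] by simp
  moreover have "covariant_derivative D S (e i) (e j) Z p
      = (\<Sum>k\<in>UNIV. coord p (Z p) k * frame_covariant_derivative c s i j k)" for i j
    using tensorial_expansion[OF covariant_derivative_tensorial_3[OF S p frame_field frame_field] Z]
    by (simp add: covariant_derivative_frame[OF S p])
  ultimately show ?thesis
    by (simp add: sum_distrib_left mult.assoc)
qed

lemma cotton_03_in_frame:
  assumes p: "p \<in> points A" and "u \<in> tangent_space A p" and "v \<in> tangent_space A p"
    and "w \<in> tangent_space A p"
  shows "cotton_03 A g D p u v w = (\<Sum>i\<in>UNIV. \<Sum>j\<in>UNIV. \<Sum>k\<in>UNIV.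
    coord p u i * coord p v j * coord p w k * frame_cotton_03 c i j k)"
proof -
  have S: "has_components (schouten A g D) (frame_schouten c)"
    by (simp add: has_components_def schouten_in_frame)
  show ?thesis
    using assms
    by (simp add: cotton_03_def Let_def covariant_derivative_in_frame[OF S p] extension)
      (simp add: frame_cotton_03_def sum_3 algebra_simps)
qed

end

text \<open>The Levi-Civita symbol is a tensor density: contraction with three rows of \<open>P\<close> multiplies it by
  the determinant.\<close>

lemma levi_civita_symbol_change_of_basis:
  fixes P :: "real^3^3"
  shows "(\<Sum>n\<in>UNIV. \<Sum>m\<in>UNIV. \<Sum>l\<in>UNIV. (\<Sum>a\<in>UNIV. \<Sum>b\<in>UNIV. P$n$a * P$m$b * x a b)
      * levi_civita_symbol n m l * (\<Sum>d\<in>UNIV. P$l$d * y d))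
    = det P * (\<Sum>a\<in>UNIV. \<Sum>b\<in>UNIV. \<Sum>d\<in>UNIV. x a b * levi_civita_symbol a b d * y d)"
  by (simp add: sum_3 levi_civita_symbol_def det_3 algebra_simps)

context homogeneous_frame
begin

text \<open>In the positively oriented frame with matrix \<open>P\<close> the Levi-Civita symbol contributes \<open>det P\<close> and
  the volume factor \<open>\<bar>det P\<bar>\<close>, since \<^const>\<open>gram\<close> has determinant \<open>- (det P)\<^sup>2\<close>. Their quotient is
  the sign \<open>s\<close>, which tells whether \<open>e\<close> is positively oriented at \<open>p\<close>.\<close>

lemma cotton_in_frame:
  assumes or: "orientation T A Or" and p: "p \<in> points A"
  shows "\<exists>s. (s = 1 \<or> s = -1) \<and> (\<forall>u\<in>tangent_space A p. \<forall>v\<in>tangent_space A p.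
    cotton A g Or D p u v = s * (\<Sum>i\<in>UNIV. \<Sum>j\<in>UNIV. coord p u i * coord p v j * frame_cotton c i j))"
proof -
  define b where "b = (SOME b. b \<in> Or p)"
  have "b \<in> Or p"
    unfolding b_def using or p by (auto simp: orientation_def some_in_eq)
  then have b: "is_frame (tangent_space A p) b"
    using or p by (auto simp: orientation_def)
  define P where "P = frame_matrix p b"
  obtain Q where "Q ** P = mat 1"
    using frame_matrix_left_inverse[OF p b] unfolding P_def .
  then have "det Q * det P = 1"
    by (metis det_I det_mul)
  then have det: "det P \<noteq> 0"
    by auto
  have "det (gram (g p) b) = - (det P)\<^sup>2"
    by (simp add: gram_frame[OF p b] det_mul det_lorentz_matrix det_transpose power2_eq_square flip: P_def)
  then have sqrt: "sqrt \<bar>det (gram (g p) b)\<bar> = \<bar>det P\<bar>"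
    by simp
  have P: "coord p (b i) a = P $ i $ a" for i a
    by (simp add: P_def frame_matrix_def)
  show ?thesis
  proof (intro exI[of _ "sgn (det P)"] conjI ballI)
    show "sgn (det P) = 1 \<or> sgn (det P) = -1"
      using det by (auto simp: sgn_if)
    fix u v
    assume u: "u \<in> tangent_space A p" and v: "v \<in> tangent_space A p"
    define x where "x = (\<lambda>a b. \<Sum>k\<in>UNIV. coord p u k * frame_cotton_03 c a b k)"
    define y where "y = (\<lambda>d. lorentz_sign d d * coord p v d)"
    have "cotton_03 A g D p (b n) (b m) u = (\<Sum>a\<in>UNIV. \<Sum>b\<in>UNIV. P$n$a * P$m$b * x a b)" for n m
      by (simp add: cotton_03_in_frame[OF p] frame_tangent_space[OF b] u P x_def sum_distrib_left mult.assoc)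
    moreover have "g p (b l) v = (\<Sum>d\<in>UNIV. P$l$d * y d)" for l
      by (simp add: metric_in_frame[OF p] frame_tangent_space[OF b] v P y_def mult_ac)
    ultimately have "cotton A g Or D p u v = 1 / (2 * \<bar>det P\<bar>) *
        (det P * (\<Sum>a\<in>UNIV. \<Sum>b\<in>UNIV. \<Sum>d\<in>UNIV. x a b * levi_civita_symbol a b d * y d))"
      by (simp only: cotton_def Let_def b_def[symmetric] sqrt levi_civita_symbol_change_of_basis)
    also have "\<dots> = sgn (det P) *
        ((\<Sum>a\<in>UNIV. \<Sum>b\<in>UNIV. \<Sum>d\<in>UNIV. x a b * levi_civita_symbol a b d * y d) / 2)"
      using det by (simp add: sgn_if)
    also have "(\<Sum>a\<in>UNIV. \<Sum>b\<in>UNIV. \<Sum>d\<in>UNIV. x a b * levi_civita_symbol a b d * y d) / 2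
        = (\<Sum>i\<in>UNIV. \<Sum>j\<in>UNIV. coord p u i * coord p v j * frame_cotton c i j)"
      by (simp add: x_def y_def frame_cotton_def sum_3 levi_civita_symbol_def field_simps)
    finally show "cotton A g Or D p u v
        = sgn (det P) * (\<Sum>i\<in>UNIV. \<Sum>j\<in>UNIV. coord p u i * coord p v j * frame_cotton c i j)" .
  qed
qed

text \<open>For a field with constant coefficients all the metric coefficients have derivative zero, and only
  the bracket terms remain.\<close>

lemma lie_derivative_frame:
  assumes p: "p \<in> points A"
  shows "lie_derivative_metric g (\<Sum>m\<in>UNIV. x m *\<^sub>R e m) (e i) (e j) p
    = - (\<Sum>m\<in>UNIV. x m * (c m i j * lorentz_sign j j + c m j i * lorentz_sign i i))"
proof -
  let ?X = "\<Sum>m\<in>UNIV. x m *\<^sub>R e m"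
  have X: "?X \<in> vector_fields A"
    by (intro vector_field_sum vector_field_scaleR frame_field)
  have "?X p (\<lambda>q. g q (e i q) (e j q)) = ?X p (\<lambda>_. lorentz_sign i j)"
    by (rule tangent_cong[OF vector_field_tangent[OF X p] p metric_smooth[OF frame_field frame_field] orthonormal])
  also have "\<dots> = 0"
    by (rule tangent_const[OF vector_field_tangent[OF X p]])
  finally have deriv: "?X p (\<lambda>q. g q (e i q) (e j q)) = 0" .
  have "lie_bracket ?X (e i) = (\<Sum>m\<in>UNIV. x m *\<^sub>R lie_bracket (e m) (e i))" for i
    by (simp add: torsion_free X frame_field D_frame_sum_left D_frame_sum_right sum_subtractf scaleR_diff_right)
  also have "\<dots> i = (\<Sum>k\<in>UNIV. (\<Sum>m\<in>UNIV. x m * c m i k) *\<^sub>R e k)" for i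
    by (simp add: structure_constants sum_3 algebra_simps)
  finally have br: "lie_bracket ?X (e i) p = (\<Sum>k\<in>UNIV. (\<Sum>m\<in>UNIV. x m * c m i k) *\<^sub>R e k p)" for i
    by (simp add: sum_fun_apply scaleR_fun_apply)
  have g1: "g p (lie_bracket ?X (e i) p) (e j p) = (\<Sum>m\<in>UNIV. x m * c m i j) * lorentz_sign j j" for i j
    using p by (simp add: br metric_sum frame_tangent orthonormal)
  moreover have "g p (e i p) (lie_bracket ?X (e j) p) = (\<Sum>m\<in>UNIV. x m * c m j i) * lorentz_sign i i"
    using p g1[of j i] by (simp add: metric_sym[of p "e i p"] frame_tangent vector_field_tangent
        lie_bracket_field X frame_field)
  ultimately show ?thesis
    unfolding lie_derivative_metric_def deriv
    by (simp add: sum_distrib_right sum.distrib distrib_left mult.assoc flip: sum_negf)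
qed

end


section \<open>Type IV.1\<close>

definition type_IV1_constants :: "real \<Rightarrow> real \<Rightarrow> real \<Rightarrow> real \<Rightarrow> 3 \<Rightarrow> 3 \<Rightarrow> 3 \<Rightarrow> real" where
  "type_IV1_constants \<alpha> \<beta> \<gamma> \<delta> i j k =
     (let b13 = (if k = 1 then \<alpha> else if k = 2 then \<beta> else 0);
          b23 = (if k = 1 then \<gamma> else if k = 2 then \<delta> else 0)
      in if i = 1 \<and> j = 3 then b13 else if i = 3 \<and> j = 1 then - b13
         else if i = 2 \<and> j = 3 then b23 else if i = 3 \<and> j = 2 then - b23 else 0)"

lemma lie_bracket_type_IV1:
  assumes "lie_bracket (e 1) (e 2) = 0"
    and "lie_bracket (e 1) (e 3) = \<alpha> *\<^sub>R e 1 + \<beta> *\<^sub>R e 2"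
    and "lie_bracket (e 2) (e 3) = \<gamma> *\<^sub>R e 1 + \<delta> *\<^sub>R e 2"
  shows "lie_bracket (e i) (e j) = (\<Sum>k\<in>UNIV. type_IV1_constants \<alpha> \<beta> \<gamma> \<delta> i j k *\<^sub>R e k)"
proof -
  have skew: "lie_bracket X Y = - lie_bracket Y X" for X Y :: "'a field"
    by (simp add: lie_bracket_def fun_eq_iff)
  have self: "lie_bracket X X = 0" for X :: "'a field"
    by (simp add: lie_bracket_def fun_eq_iff)
  show ?thesis
    using exhaust_3[of i] exhaust_3[of j] assms skew[of "e 2" "e 1"] skew[of "e 3" "e 1"] skew[of "e 3" "e 2"]
    by (auto simp: self type_IV1_constants_def sum_3)
qed

text \<open>The parameters are those of \<open>type_IV1_parametrisation\<close> below; in this form the Ricci tensor is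
  diagonal, which keeps the Cotton components short.\<close>

lemma frame_ricci_type_IV1:
  fixes m n v :: real
  defines "c \<equiv> type_IV1_constants m (m * v) (n * v) n"
  shows "frame_ricci c 1 1 = m\<^sup>2 + m * n + (n\<^sup>2 - m\<^sup>2) * v\<^sup>2 / 2"
    and "frame_ricci c 2 2 = - n\<^sup>2 - m * n + (n\<^sup>2 - m\<^sup>2) * v\<^sup>2 / 2"
    and "frame_ricci c 3 3 = - m\<^sup>2 - n\<^sup>2 + (m - n)\<^sup>2 * v\<^sup>2 / 2"
    and "i \<noteq> j \<Longrightarrow> frame_ricci c i j = 0"
proof -
  show "frame_ricci c 1 1 = m\<^sup>2 + m * n + (n\<^sup>2 - m\<^sup>2) * v\<^sup>2 / 2"
    by (simp add: c_def frame_ricci_def frame_curvature_def christoffel_def type_IV1_constants_def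
        lorentz_sign_def sum_3) (simp add: field_simps power2_eq_square)
  show "frame_ricci c 2 2 = - n\<^sup>2 - m * n + (n\<^sup>2 - m\<^sup>2) * v\<^sup>2 / 2"
    by (simp add: c_def frame_ricci_def frame_curvature_def christoffel_def type_IV1_constants_def
        lorentz_sign_def sum_3) (simp add: field_simps power2_eq_square)
  show "frame_ricci c 3 3 = - m\<^sup>2 - n\<^sup>2 + (m - n)\<^sup>2 * v\<^sup>2 / 2"
    by (simp add: c_def frame_ricci_def frame_curvature_def christoffel_def type_IV1_constants_def
        lorentz_sign_def sum_3) (simp add: field_simps power2_eq_square)
  assume "i \<noteq> j"
  then show "frame_ricci c i j = 0"
    using exhaust_3[of i] exhaust_3[of j]
    by (auto simp: c_def frame_ricci_def frame_curvature_def christoffel_def type_IV1_constants_def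
        lorentz_sign_def sum_3) (simp_all add: field_simps power2_eq_square)
qed

lemma frame_schouten_diagonal:
  assumes "\<And>i j. i \<noteq> j \<Longrightarrow> frame_ricci c i j = 0"
  shows "frame_schouten c i j = (if i = j then frame_schouten c i i else 0)"
  using assms by (simp add: frame_schouten_def lorentz_sign_def)

lemma frame_cotton_type_IV1:
  fixes m n v :: real
  defines "c \<equiv> type_IV1_constants m (m * v) (n * v) n"
  shows "frame_cotton c 1 1 = - (v * (v\<^sup>2 - 1) * (m - n) * (m\<^sup>2 + m * n + 2 * n\<^sup>2)) / 2"
    and "frame_cotton c 2 2 = - (v * (v\<^sup>2 - 1) * (m - n) * (2 * m\<^sup>2 + m * n + n\<^sup>2)) / 2"
    and "frame_cotton c 3 3 = v * (v\<^sup>2 - 1) * (m - n)\<^sup>2 * (m + n) / 2"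
    and "frame_cotton c 1 2 = - (m * n * (m - n) * (v\<^sup>2 - 1))"
    and "frame_cotton c 2 1 = - (m * n * (m - n) * (v\<^sup>2 - 1))"
    and "frame_cotton c 1 3 = 0" and "frame_cotton c 3 1 = 0"
    and "frame_cotton c 2 3 = 0" and "frame_cotton c 3 2 = 0"
proof -
  note ricci = frame_ricci_type_IV1[where m = m and n = n and v = v, folded c_def]
  have S: "frame_schouten c i j = (if i = j then frame_schouten c i i else 0)" for i j
    by (rule frame_schouten_diagonal) (rule ricci(4))
  have off: "i \<noteq> j \<Longrightarrow> frame_schouten c i j = 0" for i j
    using S[of i j] by simp
  note schouten = frame_schouten_def[of c 1 1] frame_schouten_def[of c 2 2] frame_schouten_def[of c 3 3]
  have c: "c i j k = type_IV1_constants m (m * v) (n * v) n i j k" for i j k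
    by (simp add: c_def)
  \<comment> \<open>The values of the symbol and the vanishing off-diagonal Schouten components come before the
    Christoffel symbols, so that only a few of these have to be expanded.\<close>
  note expand = frame_cotton_def frame_cotton_03_def frame_covariant_derivative_def
    levi_civita_symbol_def sum_3 lorentz_sign_def off
  note table = c christoffel_def type_IV1_constants_def lorentz_sign_def
  show "frame_cotton c 1 1 = - (v * (v\<^sup>2 - 1) * (m - n) * (m\<^sup>2 + m * n + 2 * n\<^sup>2)) / 2"
    by (simp add: expand, simp add: table,
        simp add: schouten ricci sum_3 lorentz_sign_def, simp add: field_simps power2_eq_square)
  show "frame_cotton c 2 2 = - (v * (v\<^sup>2 - 1) * (m - n) * (2 * m\<^sup>2 + m * n + n\<^sup>2)) / 2"
    by (simp add: expand, simp add: table,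
        simp add: schouten ricci sum_3 lorentz_sign_def, simp add: field_simps power2_eq_square)
  show "frame_cotton c 3 3 = v * (v\<^sup>2 - 1) * (m - n)\<^sup>2 * (m + n) / 2"
    by (simp add: expand, simp add: table,
        simp add: schouten ricci sum_3 lorentz_sign_def, simp add: field_simps power2_eq_square)
  show "frame_cotton c 1 2 = - (m * n * (m - n) * (v\<^sup>2 - 1))"
    by (simp add: expand, simp add: table,
        simp add: schouten ricci sum_3 lorentz_sign_def, simp add: field_simps power2_eq_square)
  show "frame_cotton c 2 1 = - (m * n * (m - n) * (v\<^sup>2 - 1))"
    by (simp add: expand, simp add: table,
        simp add: schouten ricci sum_3 lorentz_sign_def, simp add: field_simps power2_eq_square)
  show "frame_cotton c 1 3 = 0" "frame_cotton c 3 1 = 0"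
    "frame_cotton c 2 3 = 0" "frame_cotton c 3 2 = 0"
    by (simp_all add: expand, simp_all add: table)
qed

text \<open>Here \<open>x\<close> is the coefficient of \<open>e\<^sub>3\<close> in the soliton field and \<open>l\<close> the soliton constant. All
  diagonal components of the Cotton tensor are multiples of \<open>w\<close>, and eliminating \<open>x\<close> and \<open>l\<close> leaves
  a positive definite quadratic form in \<open>(m, n)\<close> times \<open>w\<close>. The component at \<open>(1, 2)\<close> is not a multiple
  of \<open>w\<close>, but its equation forces it to vanish once \<open>x = 0\<close>.\<close>

lemma soliton_equations_imp_cotton_zero:
  fixes m n v s x l :: real
  defines "c \<equiv> type_IV1_constants m (m * v) (n * v) n"
  assumes mn: "m + n \<noteq> 0" and s: "s = 1 \<or> s = -1"
    and eq11: "- 2 * x * m + s * frame_cotton c 1 1 = - l"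
    and eq22: "2 * x * n + s * frame_cotton c 2 2 = l"
    and eq33: "s * frame_cotton c 3 3 = l"
    and eq12: "x * v * (m - n) + s * frame_cotton c 1 2 = 0"
  shows "frame_cotton c i j = 0"
proof -
  note cotton = frame_cotton_type_IV1[where m = m and n = n and v = v, folded c_def]
  define w where "w = s * v * (v\<^sup>2 - 1) * (m - n) / 2"
  have K11: "s * frame_cotton c 1 1 = - (w * (m\<^sup>2 + m * n + 2 * n\<^sup>2))"
    and K22: "s * frame_cotton c 2 2 = - (w * (2 * m\<^sup>2 + m * n + n\<^sup>2))"
    and K33: "s * frame_cotton c 3 3 = w * (m - n) * (m + n)"
    by (simp_all add: cotton w_def power2_eq_square)
  have trace: "s * frame_cotton c 1 1 = s * frame_cotton c 2 2 + s * frame_cotton c 3 3"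
    unfolding K11 K22 K33 by (simp add: power2_eq_square algebra_simps)
  have l: "3 * l = 2 * x * (m + n)"
    using trace eq11 eq22 eq33 by (simp add: algebra_simps)
  have "(3 * w * (m - n)) * (m + n) = 3 * (s * frame_cotton c 3 3)"
    unfolding K33 by (simp only: mult.assoc)
  also have "\<dots> = (2 * x) * (m + n)"
    using l eq33 by (simp only:)
  finally have "(3 * w * (m - n)) * (m + n) = (2 * x) * (m + n)" .
  then have x: "2 * x = 3 * w * (m - n)"
    using mn by simp
  have "2 * x * (m - 2 * n) = 3 * (l - 2 * x * n)"
    using l by (simp add: algebra_simps)
  also have "\<dots> = - 3 * w * (2 * m\<^sup>2 + m * n + n\<^sup>2)"
    using eq22 unfolding K22 by (simp add: algebra_simps)
  finally have "w * ((m - n)\<^sup>2 + 2 * m\<^sup>2 + 2 * n\<^sup>2) = 0"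
    unfolding x by (simp add: power2_eq_square algebra_simps)
  moreover have "(m - n)\<^sup>2 + 2 * m\<^sup>2 + 2 * n\<^sup>2 > 0"
    using mn by (smt (verit) zero_le_power2 zero_less_power2)
  ultimately have w: "w = 0"
    by simp
  then have "x = 0"
    using x by simp
  then have "frame_cotton c 1 1 = 0" "frame_cotton c 2 2 = 0" "frame_cotton c 3 3 = 0" "frame_cotton c 1 2 = 0"
    using K11 K22 K33 eq12 s w by auto
  then show ?thesis
    using exhaust_3[of i] exhaust_3[of j] cotton(4-9) by auto
qed

text \<open>The condition \<open>\<alpha>\<gamma> = \<beta>\<delta>\<close> says that \<open>(\<alpha>, \<beta>)\<close> and \<open>(\<delta>, \<gamma>)\<close> are parallel. As
  \<open>\<alpha> + \<delta> \<noteq> 0\<close>, their common direction is that of the sum \<open>(\<alpha> + \<delta>, \<beta> + \<gamma>)\<close>, and \<open>v\<close> is its slope.\<close>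

lemma type_IV1_parametrisation:
  fixes \<alpha> \<beta> \<gamma> \<delta> :: real
  assumes "\<alpha> + \<delta> \<noteq> 0" and "\<alpha> * \<gamma> - \<beta> * \<delta> = 0"
  obtains v where "\<beta> = \<alpha> * v" and "\<gamma> = \<delta> * v"
proof (rule that)
  show "\<beta> = \<alpha> * ((\<beta> + \<gamma>) / (\<alpha> + \<delta>))" "\<gamma> = \<delta> * ((\<beta> + \<gamma>) / (\<alpha> + \<delta>))"
    using assms by (simp_all add: field_simps)
qed

theorem theorem9:
  fixes G :: "'a monoid"
    and T :: "'a topology"
    and A :: "'a atlas"
    and g :: "'a metric"
    and Or :: "'a \<Rightarrow> (3 \<Rightarrow> 'a tangent) set"
    and nabla :: "'a connection"
  assumes "lie_group G T A"
    and "connected_space T"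
    and "simply_connected_space T"
    and "lorentzian_metric A g"
    and "left_invariant_metric G A g"
    and "orientation T A Or"
    and "levi_civita_connection A g nabla"
    and "nonunimodular_type_IV1 G A g"
    and "\<exists>X\<in>left_invariant_fields G A. \<exists>c. cotton_soliton A g Or nabla X c"
  shows "\<forall>p\<in>carrier G. \<forall>u\<in>tangent_space A p. \<forall>v\<in>tangent_space A p. cotton A g Or nabla p u v = 0"
proof (intro ballI)
  have carrier: "carrier G = points A" and open_chart: "\<And>U \<phi>. (U, \<phi>) \<in> A \<Longrightarrow> open (\<phi> ` U)"
    using assms(1) by (auto simp: lie_group_def smooth_manifold_def)
  obtain e \<alpha> \<beta> \<gamma> \<delta> where e: "is_frame (left_invariant_fields G A) e"
    and orthonormal: "\<And>i j p. p \<in> carrier G \<Longrightarrow> g p (e i p) (e j p) = lorentz_sign i j"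
    and brackets: "lie_bracket (e 1) (e 2) = 0" "lie_bracket (e 1) (e 3) = \<alpha> *\<^sub>R e 1 + \<beta> *\<^sub>R e 2"
      "lie_bracket (e 2) (e 3) = \<gamma> *\<^sub>R e 1 + \<delta> *\<^sub>R e 2"
    and nonunimodular: "\<alpha> + \<delta> \<noteq> 0" and orthogonal: "\<alpha> * \<gamma> - \<beta> * \<delta> = 0"
    using assms(8) unfolding nonunimodular_type_IV1_def by blast
  obtain v where v: "\<beta> = \<alpha> * v" "\<gamma> = \<delta> * v"
    using type_IV1_parametrisation[OF nonunimodular orthogonal] .
  define c where "c = type_IV1_constants \<alpha> (\<alpha> * v) (\<delta> * v) \<delta>"
  have span_e: "span (range e) = left_invariant_fields G A" and inj_e: "inj e"
    using e by (simp_all add: is_frame_def)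
  have "e i \<in> vector_fields A" for i
    using span_base[of "e i" "range e"] unfolding span_e by (simp add: left_invariant_fields_def)
  then interpret homogeneous_frame A g nabla e c
    using assms(4,7) open_chart orthonormal lie_bracket_type_IV1[OF brackets]
    by unfold_locales (auto simp: carrier c_def v)
  obtain X l where X: "X \<in> left_invariant_fields G A" and soliton: "cotton_soliton A g Or nabla X l"
    using assms(9) by blast
  obtain x where x: "X = (\<Sum>m\<in>UNIV. x m *\<^sub>R e m)"
  proof -
    obtain f where "X = (\<Sum>E\<in>range e. f E *\<^sub>R E)"
      using X unfolding span_e[symmetric] by (auto simp: span_finite)
    then show thesis
      by (intro that[of "\<lambda>m. f (e m)"]) (simp add: sum.reindex inj_e)
  qed
  fix p u w
  assume "p \<in> carrier G" and u: "u \<in> tangent_space A p" and w: "w \<in> tangent_space A p"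
  then have p: "p \<in> points A"
    by (simp add: carrier)
  obtain s where s: "s = 1 \<or> s = -1"
    and cotton: "\<And>u v. u \<in> tangent_space A p \<Longrightarrow> v \<in> tangent_space A p \<Longrightarrow>
      cotton A g Or nabla p u v = s * (\<Sum>i\<in>UNIV. \<Sum>j\<in>UNIV. coord p u i * coord p v j * frame_cotton c i j)"
    using cotton_in_frame[OF assms(6) p] by blast
  have "cotton A g Or nabla p (e i p) (e j p) = s * frame_cotton c i j" for i j
    using p exhaust_3[of i] exhaust_3[of j] by (auto simp: cotton frame_tangent coord_frame sum_3)
  moreover have "lie_derivative_metric g X (e i) (e j) p + cotton A g Or nabla p (e i p) (e j p)
      = l * lorentz_sign i j" for i j
    using soliton p by (simp add: cotton_soliton_def frame_field orthonormal carrier)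
  ultimately have eq: "- (\<Sum>m\<in>UNIV. x m * (c m i j * lorentz_sign j j + c m j i * lorentz_sign i i))
      + s * frame_cotton c i j = l * lorentz_sign i j" for i j
    using p by (simp add: x lie_derivative_frame)
  have "frame_cotton c i j = 0" for i j
    unfolding c_def
    by (rule soliton_equations_imp_cotton_zero[OF nonunimodular s, of "x 3" v l];
        use eq[of 1 1] eq[of 2 2] eq[of 3 3] eq[of 1 2] in
        \<open>simp add: c_def[symmetric]; simp add: c_def type_IV1_constants_def lorentz_sign_def sum_3 algebra_simps\<close>)
  then show "cotton A g Or nabla p u w = 0"
    using u w by (simp add: cotton)
qed

end
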